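(* Let $W$ be a binary-input cq channel and $\delta\in(0,1)$. As $N=2^n\to\infty$ through powers of two, $$\frac1N\big|\{i\in\{1,\dots,N\}: I(W_N^{(i)})\in(1-\delta,1]\}\big|\to I(W),\qquad \frac1N\big|\{i\in\{1,\dots,N\}: I(W_N^{(i)})\in[0,\delta)\}\big|\to 1-I(W).$$
   Context: A binary-input cq channel $W$ assigns to $x\in\{0,1\}$ a density operator $\rho_x$ on a finite-dimensional Hilbert space. For a binary-input cq channel $V:x\mapsto\sigma_x$, $I(V)=H(\tfrac12(\sigma_0+\sigma_1))-\tfrac12H(\sigma_0)-\tfrac12H(\sigma_1)$, $H(\sigma)=-\mathrm{Tr}\{\sigma\log_2\sigma\}$. Channel combining: for $N=2^n$ define $\rho_{u^N}$ on $B^N=B_1\cdots B_N$ recursively by $\rho_{u_1}=\rho_{u_1}$ ($N=1$) and $\rho_{u^{2N}}=\rho^{B_1\cdots B_N}_{u_o\oplus u_e}\otimes\rho^{B_{N+1}\cdots B_{2N}}_{u_e}$ with $u_o=(u_1,u_3,\dots,u_{2N-1})$, $u_e=(u_2,\dots,u_{2N})$. Split channels: $\overline\rho_{u_1^i}=\sum_{u_{i+1}^N}2^{-(N-i)}\rho_{u^N}$ and $W_N^{(i)}:u_i\mapsto\sum_{u_1^{i-1}}2^{-(i-1)}|u_1^{i-1}\rangle\langle u_1^{i-1}|^{U_1^{i-1}}\otimes\overline\rho_{u_1^i}^{B^N}$, with $U_1^{i-1}$ a classical register with orthonormal basis $\{|u_1^{i-1}\rangle\}$. *)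

theory Defs
  imports Complex_Main "Jordan_Normal_Form.Schur_Decomposition" "Jordan_Normal_Form.Char_Poly"
begin

definition mtrace :: "complex mat \<Rightarrow> complex" where
  "mtrace A = (\<Sum>i<dim_row A. A $$ (i,i))"

definition density_op :: "nat \<Rightarrow> complex mat \<Rightarrow> bool" where
  "density_op d A \<longleftrightarrow> A \<in> carrier_mat d d \<and> mat_adjoint A = A \<and>
     (\<forall>v \<in> carrier_vec d. 0 \<le> Re (scalar_prod (conjugate v) (A *\<^sub>v v))) \<and> mtrace A = 1"

definition xlogx :: "real \<Rightarrow> real" where
  "xlogx x = (if x \<le> 0 then 0 else x * log 2 x)"

(* von Neumann entropy H(A) = - Tr(A log2 A) = - sum over eigenvalues (with algebraic
   multiplicity) of lambda log2 lambda *)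
definition vn_entropy :: "complex mat \<Rightarrow> real" where
  "vn_entropy A = - (\<Sum>z\<in>{z. poly (char_poly A) z = 0}.
      real (order z (char_poly A)) * xlogx (Re z))"

(* binary-input cq channel: inputs encoded as bool (False = 0, True = 1) *)
definition sym_info :: "(bool \<Rightarrow> complex mat) \<Rightarrow> real" where
  "sym_info V = vn_entropy ((1/2::complex) \<cdot>\<^sub>m (V False + V True))
      - vn_entropy (V False) / 2 - vn_entropy (V True) / 2"

(* Kronecker (tensor) product; the first factor corresponds to the leftmost systems *)
definition kron :: "complex mat \<Rightarrow> complex mat \<Rightarrow> complex mat" where
  "kron A B = mat (dim_row A * dim_row B) (dim_col A * dim_col B)
     (\<lambda>(i,j). A $$ (i div dim_row B, j div dim_col B) * B $$ (i mod dim_row B, j mod dim_col B))"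

(* u_o = (u_1,u_3,...) and u_e = (u_2,u_4,...) (1-indexed) for a list of length 2N *)
definition odds :: "bool list \<Rightarrow> bool list" where
  "odds u = map (\<lambda>k. u ! (2*k)) [0..<length u div 2]"
definition evens :: "bool list \<Rightarrow> bool list" where
  "evens u = map (\<lambda>k. u ! (2*k+1)) [0..<length u div 2]"

(* channel combining: comb W n u = rho_{u^N} for N = 2^n, u a list of length N *)
fun comb :: "(bool \<Rightarrow> complex mat) \<Rightarrow> nat \<Rightarrow> bool list \<Rightarrow> complex mat" where
  "comb W 0 u = W (u ! 0)"
| "comb W (Suc n) u = kron (comb W n (map2 (\<noteq>) (odds u) (evens u))) (comb W n (evens u))"

definition msum :: "nat \<Rightarrow> 'b set \<Rightarrow> ('b \<Rightarrow> complex mat) \<Rightarrow> complex mat" where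
  "msum D S f = mat D D (\<lambda>ij. \<Sum>x\<in>S. f x $$ ij)"

definition avg_state :: "(bool \<Rightarrow> complex mat) \<Rightarrow> nat \<Rightarrow> bool list \<Rightarrow> complex mat" where
  "avg_state W n u = (let N = 2^n; i = length u in
     msum (dim_row (W False) ^ N) {v. length v = N - i}
       (\<lambda>v. (1 / 2^(N - i) :: complex) \<cdot>\<^sub>m comb W n (u @ v)))"

(* index of the classical basis vector |u_1^{i-1}> (binary encoding) *)
fun bits_to_nat :: "bool list \<Rightarrow> nat" where
  "bits_to_nat [] = 0"
| "bits_to_nat (b # bs) = (if b then 1 else 0) + 2 * bits_to_nat bs"

definition basis_proj :: "nat \<Rightarrow> nat \<Rightarrow> complex mat" where
  "basis_proj D k = mat D D (\<lambda>(a,b). if a = k \<and> b = k then 1 else 0)"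

definition split_chan :: "(bool \<Rightarrow> complex mat) \<Rightarrow> nat \<Rightarrow> nat \<Rightarrow> bool \<Rightarrow> complex mat" where
  "split_chan W n i x = msum (2^(i - 1) * dim_row (W False) ^ (2^n)) {u. length u = i - 1}
     (\<lambda>u. (1 / 2^(i - 1) :: complex) \<cdot>\<^sub>m kron (basis_proj (2^(i - 1)) (bits_to_nat u)) (avg_state W n (u @ [x])))"

end

theory Submission
  imports Defs
begin

text \<open>
  Write \<open>\<rho>(u)\<close> for the averaged state of a prefix \<open>u\<close>. The information of the \<open>i\<close>-th split channel is
  \<open>h(i - 1) - h(i)\<close>, where \<open>h(j)\<close> averages the entropy of \<open>\<rho>(u)\<close> over the prefixes of length \<open>j\<close>.
  A prefix of length \<open>2 j\<close> at level \<open>n + 1\<close> has state \<open>\<rho>(odds \<oplus> evens) \<otimes> \<rho>(evens)\<close>, so \<open>h\<close> doubles and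
  the informations form a martingale along the binary tree of channels, with values in \<open>[0,1]\<close>.
  The overlap \<open>q = Tr (\<surd>\<rho>\<^sub>0 \<surd>\<rho>\<^sub>1)\<close>, averaged over prefixes, is squared exactly by the plus transform.
  It controls the information independently of the dimension:
  \<open>1 - q / ln 2 \<le> I \<le> 2 / ln 2 * (\<epsilon> + (1 - q) / (2 \<epsilon>))\<close> for all \<open>\<epsilon> > 0\<close>.
  Hence if \<open>I \<ge> \<delta>\<close>, a number \<open>k\<close> of plus transforms that depends only on \<open>\<delta>\<close> brings \<open>I\<close> above
  \<open>1 - \<delta> / 2\<close>. As the increments of a bounded martingale vanish in mean square, the fraction of
  channels with \<open>\<delta> \<le> I \<le> 1 - \<delta>\<close> tends to \<open>0\<close>, and the two limits follow since the mean of \<open>I\<close> is constant.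
\<close>

section \<open>The spectral theorem for Hermitian matrices\<close>

text \<open>The states live in dimension d^(2^n), so every estimate between I and q must be free of
  the dimension. The source of such estimates is that each input state is at most twice the average
  state \<omega>. Pairing the two eigenbases turns the quantum relative entropy of an input state
  against \<omega> into a classical one (the Nussbaum-Szkola distributions); there the domination
  bounds a chi-square sum by 2, and elementary inequalities for ln suffice. It remains to compare
  the traces Tr(sqrt \<rho>_x sqrt \<omega>) with q: one direction is AM-GM in the Hilbert-Schmidt
  norm, the other is operator concavity of the square root. The squaring of q is an equality even
  after averaging, because the two halves of a combined word have independent prefixes. Only plus
  paths are followed: a channel that is neither good nor bad would have to jump along its own plus
  path, against the smallness of the increments. Thus mean squares are enough, without a limit
  random variable or almost sure convergence.\<close>

text \<open>Vectors are functions \<open>nat \<Rightarrow> complex\<close> of which only the values below \<open>d\<close> matter.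
  Eigenbases are indexed by arbitrary finite sets \<open>J\<close>, so that those of Kronecker products and of
  block diagonal matrices are indexed by pairs.\<close>

definition ip :: "nat \<Rightarrow> (nat \<Rightarrow> complex) \<Rightarrow> (nat \<Rightarrow> complex) \<Rightarrow> complex" where
  "ip d u v = (\<Sum>a<d. cnj (u a) * v a)"

definition nrm2 :: "nat \<Rightarrow> (nat \<Rightarrow> complex) \<Rightarrow> real" where
  "nrm2 d v = (\<Sum>a<d. (cmod (v a))\<^sup>2)"

definition mv :: "nat \<Rightarrow> complex mat \<Rightarrow> (nat \<Rightarrow> complex) \<Rightarrow> nat \<Rightarrow> complex" where
  "mv d A v a = (\<Sum>b<d. A $$ (a,b) * v b)"

definition herm :: "nat \<Rightarrow> complex mat \<Rightarrow> bool" where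
  "herm d A \<longleftrightarrow> A \<in> carrier_mat d d \<and> (\<forall>a<d. \<forall>b<d. A $$ (b,a) = cnj (A $$ (a,b)))"

text \<open>\<open>card J = d\<close> stands in for spanning: d orthonormal vectors in dimension d
  are complete, and a cardinality is easy to check for product index sets.\<close>

definition orthonormal_basis :: "nat \<Rightarrow> 'k set \<Rightarrow> ('k \<Rightarrow> nat \<Rightarrow> complex) \<Rightarrow> bool" where
  "orthonormal_basis d J x \<longleftrightarrow>
     finite J \<and> card J = d \<and> (\<forall>i\<in>J. \<forall>j\<in>J. ip d (x i) (x j) = of_bool (i = j))"

definition spectral :: "nat \<Rightarrow> complex mat \<Rightarrow> 'k set \<Rightarrow> ('k \<Rightarrow> real) \<Rightarrow> ('k \<Rightarrow> nat \<Rightarrow> complex) \<Rightarrow> bool" where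
  "spectral d A J l x \<longleftrightarrow> A \<in> carrier_mat d d \<and> orthonormal_basis d J x \<and>
     (\<forall>a<d. \<forall>b<d. A $$ (a,b) = (\<Sum>j\<in>J. of_real (l j) * x j a * cnj (x j b)))"

lemma ip_self: "ip d v v = of_real (nrm2 d v)"
  by (simp add: ip_def nrm2_def complex_norm_square mult.commute del: of_real_power)

lemma cnj_ip: "cnj (ip d u v) = ip d v u"
  by (simp add: ip_def mult.commute)

lemma nrm2_nonneg: "0 \<le> nrm2 d v"
  by (simp add: nrm2_def sum_nonneg)

lemma ip_sum_right: "ip d u (\<lambda>a. \<Sum>j\<in>J. c j * x j a) = (\<Sum>j\<in>J. c j * ip d u (x j))"
  unfolding ip_def sum_distrib_left
  by (subst sum.swap) (simp add: ac_simps)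

lemma ip_sum_left: "ip d (\<lambda>a. \<Sum>j\<in>J. c j * x j a) u = (\<Sum>j\<in>J. cnj (c j) * ip d (x j) u)"
proof -
  have "ip d (\<lambda>a. \<Sum>j\<in>J. c j * x j a) u = cnj (ip d u (\<lambda>a. \<Sum>j\<in>J. c j * x j a))"
    by (simp only: cnj_ip)
  also have "\<dots> = (\<Sum>j\<in>J. cnj (c j) * ip d (x j) u)"
    unfolding ip_sum_right by (simp only: cnj_sum complex_cnj_mult cnj_ip)
  finally show ?thesis .
qed

lemma ip_cong: "(\<And>a. a < d \<Longrightarrow> u a = u' a) \<Longrightarrow> (\<And>a. a < d \<Longrightarrow> v a = v' a) \<Longrightarrow> ip d u v = ip d u' v'"
  by (simp add: ip_def)

lemma hermD: "herm d A \<Longrightarrow> a < d \<Longrightarrow> b < d \<Longrightarrow> cnj (A $$ (b,a)) = A $$ (a,b)"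
  unfolding herm_def by (metis complex_cnj_cnj)

lemma herm_ip_mv:
  assumes "herm d A"
  shows "ip d u (mv d A v) = ip d (mv d A u) v"
proof -
  have "ip d u (mv d A v) = (\<Sum>a<d. \<Sum>b<d. cnj (u a) * A $$ (a,b) * v b)"
    by (simp add: ip_def mv_def sum_distrib_left mult.assoc)
  also have "\<dots> = (\<Sum>b<d. \<Sum>a<d. cnj (u a) * A $$ (a,b) * v b)" by (rule sum.swap)
  also have "\<dots> = (\<Sum>b<d. \<Sum>a<d. cnj (A $$ (b,a) * u a) * v b)"
    using assms by (intro sum.cong refl) (simp add: hermD mult.commute)
  also have "\<dots> = ip d (mv d A u) v"
    by (simp add: ip_def mv_def sum_distrib_right)
  finally show ?thesis .
qed

text \<open>Orthonormality is the identity V U = 1; for square matrices a left inverse is also a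
  right inverse, and U V = 1 is completeness.\<close>

lemma orthonormal_basis_unitary:
  assumes "orthonormal_basis d J x" "bij_betw h {..<d} J"
  defines "U \<equiv> mat d d (\<lambda>(a,i). x (h i) a)"
    and "V \<equiv> mat d d (\<lambda>(i,a). cnj (x (h i) a))"
  shows "V * U = 1\<^sub>m d" "U * V = 1\<^sub>m d"
proof -
  have UV: "U \<in> carrier_mat d d" "V \<in> carrier_mat d d" by (auto simp: U_def V_def)
  have h: "h i \<in> J" if "i < d" for i using assms(2) that by (auto dest: bij_betwE)
  have inj: "h i = h j \<longleftrightarrow> i = j" if "i < d" "j < d" for i j
    using bij_betw_imp_inj_on[OF assms(2)] that by (auto dest: inj_onD)
  show 1: "V * U = 1\<^sub>m d"
  proof (rule eq_matI)
    fix i j assume "i < dim_row (1\<^sub>m d)" "j < dim_col (1\<^sub>m d)"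
    then have ij: "i < d" "j < d" by auto
    have "(V * U) $$ (i,j) = ip d (x (h i)) (x (h j))"
      using ij by (simp add: U_def V_def scalar_prod_def ip_def atLeast0LessThan)
    then show "(V * U) $$ (i,j) = 1\<^sub>m d $$ (i,j)"
      using assms(1) h ij inj by (simp add: orthonormal_basis_def)
  qed (auto simp: U_def V_def)
  show "U * V = 1\<^sub>m d" using mat_mult_left_right_inverse[OF UV(2,1) 1] .
qed

lemma orthonormal_basis_complete:
  assumes "orthonormal_basis d J x" "a < d" "b < d"
  shows "(\<Sum>j\<in>J. x j a * cnj (x j b)) = of_bool (a = b)"
proof -
  have fin: "finite J" "card J = d" using assms(1) by (auto simp: orthonormal_basis_def)
  then obtain h where h: "bij_betw h {..<d} J"
    using ex_bij_betw_nat_finite[of J] by (auto simp: atLeast0LessThan)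
  let ?U = "mat d d (\<lambda>(a,i). x (h i) a)" and ?V = "mat d d (\<lambda>(i,a). cnj (x (h i) a))"
  have "(\<Sum>j\<in>J. x j a * cnj (x j b)) = (\<Sum>i<d. x (h i) a * cnj (x (h i) b))"
    by (rule sum.reindex_bij_betw[OF h, symmetric])
  also have "\<dots> = (?U * ?V) $$ (a,b)"
    using assms(2,3) by (simp add: scalar_prod_def atLeast0LessThan)
  also have "\<dots> = of_bool (a = b)"
    unfolding orthonormal_basis_unitary(2)[OF assms(1) h] using assms(2,3) by simp
  finally show ?thesis .
qed

lemma orthonormal_basis_expand:
  assumes "orthonormal_basis d J x" "a < d"
  shows "v a = (\<Sum>j\<in>J. ip d (x j) v * x j a)"
proof -
  have "(\<Sum>j\<in>J. ip d (x j) v * x j a) = (\<Sum>j\<in>J. \<Sum>b<d. v b * (x j a * cnj (x j b)))"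
    by (simp add: ip_def sum_distrib_right sum_distrib_left ac_simps)
  also have "\<dots> = (\<Sum>b<d. v b * (\<Sum>j\<in>J. x j a * cnj (x j b)))"
    by (subst sum.swap) (simp add: sum_distrib_left)
  also have "\<dots> = (\<Sum>b<d. v b * of_bool (a = b))"
    using assms by (intro sum.cong refl) (simp add: orthonormal_basis_complete)
  also have "\<dots> = v a" using assms(2) by (simp add: of_bool_def if_distrib[of "(*) _"] cong: if_cong)
  finally show ?thesis ..
qed

lemma orthonormal_basis_parseval:
  assumes "orthonormal_basis d J x"
  shows "(\<Sum>j\<in>J. (cmod (ip d (x j) v))\<^sup>2) = nrm2 d v"
proof -
  have "of_real (nrm2 d v) = ip d v v" by (simp add: ip_self)
  also have "\<dots> = ip d v (\<lambda>a. \<Sum>j\<in>J. ip d (x j) v * x j a)"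
    by (rule ip_cong[OF refl]) (rule orthonormal_basis_expand[OF assms])
  also have "\<dots> = (\<Sum>j\<in>J. ip d (x j) v * cnj (ip d (x j) v))"
    unfolding ip_sum_right cnj_ip ..
  also have "\<dots> = of_real (\<Sum>j\<in>J. (cmod (ip d (x j) v))\<^sup>2)"
    by (simp only: complex_norm_square[symmetric] of_real_sum)
  finally show ?thesis by (simp only: of_real_eq_iff)
qed

lemma spectral_from_eigenvectors:
  assumes "A \<in> carrier_mat d d" "orthonormal_basis d J x"
    and "\<And>j a. j \<in> J \<Longrightarrow> a < d \<Longrightarrow> mv d A (x j) a = of_real (l j) * x j a"
  shows "spectral d A J l x"
  unfolding spectral_def
proof (intro conjI allI impI)
  fix a b assume ab: "a < d" "b < d"
  have "A $$ (a,b) = (\<Sum>c<d. A $$ (a,c) * of_bool (c = b))"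
    using ab by (simp add: of_bool_def if_distrib[of "(*) _"] cong: if_cong)
  also have "\<dots> = (\<Sum>c<d. A $$ (a,c) * (\<Sum>j\<in>J. x j c * cnj (x j b)))"
    using assms(2) ab by (intro sum.cong refl) (simp add: orthonormal_basis_complete)
  also have "\<dots> = (\<Sum>j\<in>J. mv d A (x j) a * cnj (x j b))"
    unfolding sum_distrib_left mv_def sum_distrib_right
    by (subst sum.swap) (simp add: ac_simps)
  also have "\<dots> = (\<Sum>j\<in>J. of_real (l j) * x j a * cnj (x j b))"
    using assms(3) ab by simp
  finally show "A $$ (a,b) = (\<Sum>j\<in>J. of_real (l j) * x j a * cnj (x j b))" .
qed (use assms in auto)

text \<open>Gram-Schmidt keeps the head of the list and only yields orthogonality, so after
  normalisation the first vector is a multiple of v. An eigenvector stays one under this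
  scaling.\<close>

lemma orthonormal_basis_extend:
  assumes "v \<in> carrier_vec n" "v \<noteq> 0\<^sub>v n"
  obtains w c where "orthonormal_basis n {..<n} w" "\<And>a. a < n \<Longrightarrow> w 0 a = c * v $ a"
proof -
  interpret cof_vec_space n "TYPE(complex)" .
  define b where "b = basis_completion v"
  define ws where "ws = gram_schmidt n b"
  note bc = basis_completion[OF assms, folded b_def]
  have n: "n \<noteq> 0" using assms by (metis carrier_vecD eq_vecI index_zero_vec(2) less_zeroE)
  obtain vs where bv: "b = v # vs" using bc(6,7) n by (cases b) auto
  from gram_schmidt_result[OF bc(2,4,5) refl, folded ws_def]
  have ws: "set ws \<subseteq> carrier_vec n" "corthogonal ws" "length ws = n" using bc(6) by auto
  from gram_schmidt_hd[OF assms(1), of vs, folded bv] have hdws: "hd ws = v" unfolding ws_def .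
  then have ws0: "ws ! 0 = v" using ws n by (metis hd_conv_nth list.size(3))
  define w0 where "w0 = (\<lambda>i a. ws ! i $ a)"
  define c where "c = (\<lambda>i. complex_of_real (1 / sqrt (nrm2 n (w0 i))))"
  define w where "w = (\<lambda>i a. c i * w0 i a)"
  have car: "ws ! i \<in> carrier_vec n" if "i < n" for i using ws that by (metis nth_mem subsetD)
  have ip0: "ip n (w0 i) (w0 j) = 0 \<longleftrightarrow> i \<noteq> j" if ij: "i < n" "j < n" for i j
  proof -
    have "ip n (w0 i) (w0 j) = ws ! j \<bullet>c ws ! i"
      using car[OF ij(1)] car[OF ij(2)]
      by (simp add: ip_def w0_def scalar_prod_def atLeast0LessThan mult.commute)
    then show ?thesis using ws(2,3) ij by (auto simp: corthogonal_def)
  qed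
  have nz: "nrm2 n (w0 i) > 0" if "i < n" for i
    using ip0[OF that that] nrm2_nonneg[of n "w0 i"] by (auto simp: ip_self)
  have "ip n (w i) (w j) = of_bool (i = j)" if ij: "i < n" "j < n" for i j
  proof -
    have "ip n (w i) (w j) = cnj (c i) * c j * ip n (w0 i) (w0 j)"
      by (simp add: ip_def w_def sum_distrib_left ac_simps)
    also have "\<dots> = of_bool (i = j)"
    proof (cases "i = j")
      case True
      moreover have "c j * c j * of_real (nrm2 n (w0 j)) = 1"
        using nz[OF ij(2)] unfolding c_def by (simp flip: of_real_mult)
      ultimately show ?thesis by (simp add: ip_self c_def)
    qed (use ip0[OF ij] in auto)
    finally show ?thesis .
  qed
  then have "orthonormal_basis n {..<n} w" by (auto simp: orthonormal_basis_def)
  moreover have "w 0 a = c 0 * v $ a" for a by (simp add: w_def w0_def ws0)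
  ultimately show thesis using that by blast
qed

lemma herm_mv_self_real:
  assumes "herm d A" shows "ip d v (mv d A v) \<in> \<real>"
  using herm_ip_mv[OF assms, of v v] by (simp add: Reals_cnj_iff cnj_ip)

text \<open>Induction by deflation: split off one eigenvector \<open>w 0\<close>, diagonalise the
  compression B of A to its orthogonal complement, and lift the eigenvectors of B back through the
  basis w.\<close>

lemma herm_spectral:
  assumes "herm d A"
  shows "\<exists>l x. spectral d A {..<d} l x"
  using assms
proof (induction d arbitrary: A)
  case 0
  then show ?case by (auto simp: spectral_def orthonormal_basis_def herm_def)
next
  case (Suc n)
  let ?N = "Suc n"
  have A: "A \<in> carrier_mat ?N ?N" using Suc.prems by (simp add: herm_def)
  obtain as where as: "char_poly A = (\<Prod>a\<leftarrow>as. [:- a, 1:])" "length as = ?N"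
    using char_poly_factorized[OF A] by blast
  then obtain e es where "as = e # es" by (cases as) auto
  then have "poly (char_poly A) e = 0" using as(1) by simp
  then have "eigenvalue A e" using eigenvalue_root_char_poly[OF A] by simp
  then obtain v where v: "v \<in> carrier_vec ?N" "v \<noteq> 0\<^sub>v ?N" "A *\<^sub>v v = e \<cdot>\<^sub>v v"
    using A by (auto simp: eigenvalue_def eigenvector_def)
  obtain w c where w: "orthonormal_basis ?N {..<?N} w" "\<And>a. a < ?N \<Longrightarrow> w 0 a = c * v $ a"
    using orthonormal_basis_extend[OF v(1,2)] by metis
  have on: "ip ?N (w i) (w j) = of_bool (i = j)" if "i < ?N" "j < ?N" for i j
    using w(1) that by (auto simp: orthonormal_basis_def)
  have ev: "mv ?N A (w 0) a = e * w 0 a" if "a < ?N" for a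
  proof -
    have "mv ?N A (w 0) a = c * (\<Sum>b<?N. A $$ (a,b) * v $ b)"
      by (simp add: mv_def w(2) sum_distrib_left ac_simps del: sum.lessThan_Suc)
    also have "(\<Sum>b<?N. A $$ (a,b) * v $ b) = (A *\<^sub>v v) $ a"
      using A v(1) that by (simp add: scalar_prod_def atLeast0LessThan del: sum.lessThan_Suc)
    finally show ?thesis using v that by (simp add: w(2))
  qed
  \<comment> \<open>The eigenvalue is real, being the Rayleigh quotient of the unit vector
    \<open>w 0\<close>.\<close>
  have "ip ?N (w 0) (mv ?N A (w 0)) = ip ?N (w 0) (\<lambda>a. e * w 0 a)"
    using ev by (intro ip_cong) auto
  also have "\<dots> = e * ip ?N (w 0) (w 0)"
    by (simp add: ip_def sum_distrib_left ac_simps del: sum.lessThan_Suc)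
  also have "\<dots> = e" using on[of 0 0] by simp
  finally have "e \<in> \<real>" using herm_mv_self_real[OF Suc.prems] by metis
  then obtain e' where e': "e = of_real e'" by (auto elim: Reals_cases)
  define B where "B = mat n n (\<lambda>(j,k). ip ?N (w (Suc j)) (mv ?N A (w (Suc k))))"
  have "herm n B"
    unfolding herm_def B_def
    by (auto simp: cnj_ip herm_ip_mv[OF Suc.prems])
  then obtain m y where "spectral n B {..<n} m y" using Suc.IH by blast
  then have yon: "orthonormal_basis n {..<n} y"
    and B: "\<And>a b. a < n \<Longrightarrow> b < n \<Longrightarrow> B $$ (a,b) = (\<Sum>j<n. of_real (m j) * y j a * cnj (y j b))"
    by (auto simp: spectral_def)
  have yip: "ip n (y i) (y j) = of_bool (i = j)" if "i < n" "j < n" for i j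
    using yon that by (auto simp: orthonormal_basis_def)
  have By: "mv n B (y k) a = of_real (m k) * y k a" if "a < n" "k < n" for a k
  proof -
    have "mv n B (y k) a = (\<Sum>b<n. \<Sum>j<n. of_real (m j) * y j a * (cnj (y j b) * y k b))"
      using that by (simp add: mv_def B sum_distrib_right mult.assoc)
    also have "\<dots> = (\<Sum>j<n. of_real (m j) * y j a * ip n (y j) (y k))"
      unfolding ip_def sum_distrib_left by (rule sum.swap)
    also have "\<dots> = (\<Sum>j<n. of_real (m j) * y j a * of_bool (j = k))"
      using that by (intro sum.cong refl) (simp add: yip)
    also have "\<dots> = of_real (m k) * y k a"
      using that by (simp add: of_bool_def if_distrib[of "(*) _"] cong: if_cong)
    finally show ?thesis .
  qed
  have Aw: "mv ?N A (w (Suc k)) a = (\<Sum>j<n. B $$ (j,k) * w (Suc j) a)" if "k < n" "a < ?N" for k a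
  proof -
    \<comment> \<open>The complement of \<open>w 0\<close> is invariant: moved to the left argument,
      A only scales \<open>w 0\<close>.\<close>
    have "ip ?N (w 0) (mv ?N A (w (Suc k))) = ip ?N (mv ?N A (w 0)) (w (Suc k))"
      by (rule herm_ip_mv[OF Suc.prems])
    also have "\<dots> = ip ?N (\<lambda>a. e * w 0 a) (w (Suc k))"
      using ev by (intro ip_cong) auto
    also have "\<dots> = cnj e * ip ?N (w 0) (w (Suc k))"
      by (simp add: ip_def sum_distrib_left ac_simps del: sum.lessThan_Suc)
    also have "\<dots> = 0" using on that by simp
    finally have 0: "ip ?N (w 0) (mv ?N A (w (Suc k))) = 0" .
    have "mv ?N A (w (Suc k)) a = (\<Sum>j<?N. ip ?N (w j) (mv ?N A (w (Suc k))) * w j a)"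
      by (rule orthonormal_basis_expand[OF w(1) that(2)])
    also have "\<dots> = (\<Sum>j<n. ip ?N (w (Suc j)) (mv ?N A (w (Suc k))) * w (Suc j) a)"
      by (subst sum.lessThan_Suc_shift) (simp add: 0)
    finally show ?thesis using that by (simp add: B_def)
  qed
  define x where "x = (\<lambda>i. case i of 0 \<Rightarrow> w 0 | Suc k \<Rightarrow> (\<lambda>a. \<Sum>j<n. y k j * w (Suc j) a))"
  define l where "l = (\<lambda>i. case i of 0 \<Rightarrow> e' | Suc k \<Rightarrow> m k)"
  have x0: "x 0 = w 0" and xS: "x (Suc k) = (\<lambda>a. \<Sum>j<n. y k j * w (Suc j) a)" for k
    by (auto simp: x_def)
  have "ip ?N (x i) (x j) = of_bool (i = j)" if ij: "i < ?N" "j < ?N" for i j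
  proof -
    have 1: "ip ?N (w 0) (x (Suc k)) = 0" if "k < n" for k
      unfolding xS ip_sum_right using on by simp
    have 2: "ip ?N (x (Suc k)) (x (Suc k')) = of_bool (k = k')" if k: "k < n" "k' < n" for k k'
    proof -
      have "ip ?N (x (Suc k)) (x (Suc k')) =
          (\<Sum>j<n. cnj (y k j) * (\<Sum>j'<n. y k' j' * ip ?N (w (Suc j)) (w (Suc j'))))"
        unfolding xS ip_sum_left ip_sum_right ..
      also have "\<dots> = (\<Sum>j<n. cnj (y k j) * y k' j)"
        by (intro sum.cong refl) (simp add: on of_bool_def if_distrib[of "(*) _"] cong: if_cong)
      finally show ?thesis using yip[OF k] by (simp add: ip_def)
    qed
    have 3: "ip ?N (x (Suc k)) (w 0) = 0" if "k < n" for k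
      using 1[OF that] cnj_ip[of ?N "w 0" "x (Suc k)"] by simp
    show ?thesis using ij 1 2 3 on[of 0 0] by (cases i; cases j) (auto simp: x0)
  qed
  then have xon: "orthonormal_basis ?N {..<?N} x" by (auto simp: orthonormal_basis_def)
  have "mv ?N A (x i) a = of_real (l i) * x i a" if ia: "i \<in> {..<?N}" "a < ?N" for i a
  proof (cases i)
    case 0
    then show ?thesis using ev ia by (simp add: x0 l_def e')
  next
    case (Suc k)
    then have k: "k < n" using ia by simp
    have "mv ?N A (x i) a = (\<Sum>j<n. y k j * mv ?N A (w (Suc j)) a)"
      unfolding Suc xS mv_def sum_distrib_left
      by (subst sum.swap) (simp add: ac_simps del: sum.lessThan_Suc)
    also have "\<dots> = (\<Sum>j<n. y k j * (\<Sum>j'<n. B $$ (j',j) * w (Suc j') a))"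
      using ia by (intro sum.cong refl) (simp add: Aw)
    also have "\<dots> = (\<Sum>j'<n. mv n B (y k) j' * w (Suc j') a)"
      unfolding mv_def sum_distrib_left sum_distrib_right
      by (subst sum.swap) (simp add: ac_simps)
    also have "\<dots> = of_real (l i) * x i a"
      using k by (simp add: By Suc l_def xS sum_distrib_left ac_simps)
    finally show ?thesis .
  qed
  then have "spectral ?N A {..<?N} l x" by (rule spectral_from_eigenvectors[OF A xon])
  then show ?case by blast
qed


section \<open>Spectral decompositions, entropy and positive semidefinite matrices\<close>

text \<open>S is any finite superset of the roots, because dropping a factor in the induction may
  drop a root.\<close>

lemma order_sum_linear_factors:
  fixes f :: "'a::field \<Rightarrow> real"
  assumes "finite S" "set as \<subseteq> S"
  shows "(\<Sum>z\<in>S. real (order z (\<Prod>a\<leftarrow>as. [:- a, 1:])) * f z) = (\<Sum>a\<leftarrow>as. f a)"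
  using assms(2)
proof (induction as)
  case Nil
  then show ?case by simp
next
  case (Cons a as)
  let ?p = "\<Prod>a\<leftarrow>as. [:- a, 1:]"
  have "order z (\<Prod>a\<leftarrow>a # as. [:- a, 1:]) = of_bool (z = a) + order z ?p" for z
  proof -
    have "?p \<noteq> 0" by (auto simp: prod_list_zero_iff)
    moreover have "order z [:- a, 1:] = of_bool (z = a)"
      using order_power_n_n[of a 1] by (auto simp: order_0I)
    ultimately show ?thesis by (simp add: order_mult del: mult_pCons_left)
  qed
  then have "(\<Sum>z\<in>S. real (order z (\<Prod>a\<leftarrow>a # as. [:- a, 1:])) * f z)
      = (\<Sum>z\<in>S. of_bool (z = a) * f z) + (\<Sum>z\<in>S. real (order z ?p) * f z)"
    by (simp add: distrib_right sum.distrib del: list.map prod_list.Cons)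
  also have "(\<Sum>z\<in>S. of_bool (z = a) * f z) = f a"
    using assms(1) Cons.prems by (simp add: of_bool_def if_distrib[of "\<lambda>t. t * _"] cong: if_cong)
  finally show ?case using Cons by simp
qed

lemma vn_entropy_char_poly:
  assumes "char_poly A = (\<Prod>a\<leftarrow>as. [:- a, 1:])"
  shows "vn_entropy A = - (\<Sum>a\<leftarrow>as. xlogx (Re a))"
proof -
  have "{z. poly (char_poly A) z = 0} = set as"
    unfolding assms by (induction as) auto
  then show ?thesis
    unfolding vn_entropy_def using order_sum_linear_factors[of "set as" as "\<lambda>z. xlogx (Re z)"]
    by (simp add: assms)
qed

text \<open>The entropy sees only the characteristic polynomial, and an eigenbasis makes A similar
  to a diagonal matrix. Hence any decomposition at hand computes it, in particular those indexed by
  pairs.\<close>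

lemma spectral_vn_entropy:
  assumes "spectral d A J l x"
  shows "vn_entropy A = - (\<Sum>j\<in>J. xlogx (l j))"
proof -
  have on: "orthonormal_basis d J x" and A: "A \<in> carrier_mat d d" using assms by (auto simp: spectral_def)
  then have fin: "finite J" "card J = d" by (auto simp: orthonormal_basis_def)
  then obtain h where h: "bij_betw h {..<d} J"
    using ex_bij_betw_nat_finite[of J] by (auto simp: atLeast0LessThan)
  let ?U = "mat d d (\<lambda>(a,i). x (h i) a)" and ?V = "mat d d (\<lambda>(i,a). cnj (x (h i) a))"
  let ?D = "mat d d (\<lambda>(i,j). if i = j then of_real (l (h i)) else 0)"
  have "A = ?U * ?D * ?V"
  proof (rule eq_matI)
    fix a b assume "a < dim_row (?U * ?D * ?V)" "b < dim_col (?U * ?D * ?V)"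
    then have ab: "a < d" "b < d" by auto
    have 1: "(?U * ?D) $$ (a,i) = x (h i) a * of_real (l (h i))" if "i < d" for i
      using ab that by (simp add: scalar_prod_def if_distrib[of "(*) _"] cong: if_cong)
    have "(?U * ?D * ?V) $$ (a,b) = (\<Sum>i<d. (?U * ?D) $$ (a,i) * ?V $$ (i,b))"
      using ab by (simp add: scalar_prod_def atLeast0LessThan)
    also have "\<dots> = (\<Sum>i<d. of_real (l (h i)) * x (h i) a * cnj (x (h i) b))"
      using ab by (intro sum.cong refl) (simp add: 1 ac_simps del: index_mult_mat)
    also have "\<dots> = (\<Sum>j\<in>J. of_real (l j) * x j a * cnj (x j b))"
      by (rule sum.reindex_bij_betw[OF h])
    finally show "A $$ (a,b) = (?U * ?D * ?V) $$ (a,b)"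
      using assms ab by (simp add: spectral_def)
  qed (use A in auto)
  then have "similar_mat A ?D"
    using orthonormal_basis_unitary[OF on h] A
    unfolding similar_mat_def similar_mat_wit_def Let_def by (intro exI[of _ ?U] exI[of _ ?V]) auto
  then have "char_poly A = char_poly ?D" by (rule char_poly_similar)
  also have "\<dots> = (\<Prod>a\<leftarrow>diag_mat ?D. [:- a, 1:])"
    by (rule char_poly_upper_triangular[of _ d]) auto
  finally have "vn_entropy A = - (\<Sum>a\<leftarrow>diag_mat ?D. xlogx (Re a))" by (rule vn_entropy_char_poly)
  also have "(\<Sum>a\<leftarrow>diag_mat ?D. xlogx (Re a)) = (\<Sum>i<d. xlogx (l (h i)))"
    by (simp add: diag_mat_def comp_def interv_sum_list_conv_sum_set_nat atLeast0LessThan)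
  also have "\<dots> = (\<Sum>j\<in>J. xlogx (l j))" by (rule sum.reindex_bij_betw[OF h])
  finally show ?thesis .
qed

section \<open>Positive semidefinite matrices and the Hilbert-Schmidt pairing\<close>

definition psd :: "nat \<Rightarrow> complex mat \<Rightarrow> bool" where
  "psd d A \<longleftrightarrow> herm d A \<and> (\<forall>v. 0 \<le> Re (ip d v (mv d A v)))"

text \<open>The pairing Tr(A B^dagger), written entrywise so that it factors over Kronecker products
  by reindexing.\<close>

definition hs :: "nat \<Rightarrow> complex mat \<Rightarrow> complex mat \<Rightarrow> complex" where
  "hs d A B = (\<Sum>a<d. \<Sum>b<d. A $$ (a,b) * cnj (B $$ (a,b)))"

lemma psd_herm: "psd d A \<Longrightarrow> herm d A" by (simp add: psd_def)

lemma psd_carrier: "psd d A \<Longrightarrow> A \<in> carrier_mat d d" by (simp add: psd_def herm_def)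

lemma spectral_mv:
  assumes "spectral d A J l x" "a < d"
  shows "mv d A v a = (\<Sum>j\<in>J. of_real (l j) * ip d (x j) v * x j a)"
proof -
  have "mv d A v a = (\<Sum>b<d. \<Sum>j\<in>J. of_real (l j) * x j a * cnj (x j b) * v b)"
    using assms by (simp add: mv_def spectral_def sum_distrib_right)
  also have "\<dots> = (\<Sum>j\<in>J. of_real (l j) * ip d (x j) v * x j a)"
    by (subst sum.swap) (simp add: ip_def sum_distrib_left sum_distrib_right ac_simps)
  finally show ?thesis .
qed

lemma spectral_ip_mv:
  assumes "spectral d A J l x"
  shows "ip d v (mv d A v) = of_real (\<Sum>j\<in>J. l j * (cmod (ip d (x j) v))\<^sup>2)"
proof -
  have "ip d v (mv d A v) = ip d v (\<lambda>a. \<Sum>j\<in>J. of_real (l j) * ip d (x j) v * x j a)"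
    using spectral_mv[OF assms] by (intro ip_cong) auto
  also have "\<dots> = (\<Sum>j\<in>J. of_real (l j) * (ip d (x j) v * cnj (ip d (x j) v)))"
    unfolding ip_sum_right cnj_ip by (simp add: ac_simps)
  finally show ?thesis
    by (simp only: complex_norm_square[symmetric] of_real_sum of_real_mult)
qed

lemma spectral_eigenvector:
  assumes "spectral d A J l x" "j \<in> J" "a < d"
  shows "mv d A (x j) a = of_real (l j) * x j a"
proof -
  have fin: "finite J" using assms(1) by (auto simp: spectral_def orthonormal_basis_def)
  have "mv d A (x j) a = (\<Sum>i\<in>J. of_real (l i) * of_bool (i = j) * x i a)"
    unfolding spectral_mv[OF assms(1,3)] using assms
    by (intro sum.cong refl) (simp add: spectral_def orthonormal_basis_def)
  also have "\<dots> = of_real (l j) * x j a"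
    using fin assms(2) by (simp add: of_bool_def if_distrib[of "(*) _"] if_distrib[of "\<lambda>t. t * _"] cong: if_cong)
  finally show ?thesis .
qed

lemma spectral_herm: "spectral d A J l x \<Longrightarrow> herm d A"
  by (auto simp: spectral_def herm_def ac_simps)

lemma spectral_ip_mv_eigenvector:
  assumes "spectral d A J l x" "j \<in> J"
  shows "ip d (x j) (mv d A (x j)) = of_real (l j)"
proof -
  have "ip d (x j) (mv d A (x j)) = ip d (x j) (\<lambda>a. of_real (l j) * x j a)"
    using spectral_eigenvector[OF assms] by (intro ip_cong) auto
  also have "\<dots> = of_real (l j) * ip d (x j) (x j)"
    by (simp add: ip_def sum_distrib_left ac_simps)
  finally show ?thesis using assms by (simp add: spectral_def orthonormal_basis_def)
qed

lemma spectral_psd_iff: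
  assumes "spectral d A J l x"
  shows "psd d A \<longleftrightarrow> (\<forall>j\<in>J. 0 \<le> l j)"
proof
  assume "psd d A"
  then show "\<forall>j\<in>J. 0 \<le> l j"
    using spectral_ip_mv_eigenvector[OF assms] unfolding psd_def by (metis Re_complex_of_real)
next
  assume "\<forall>j\<in>J. 0 \<le> l j"
  then show "psd d A"
    by (auto simp: psd_def spectral_herm[OF assms] spectral_ip_mv[OF assms] intro!: sum_nonneg)
qed

lemma psd_spectral:
  assumes "psd d A"
  obtains l x where "spectral d A {..<d} l x" "\<And>j. j < d \<Longrightarrow> 0 \<le> l j"
proof -
  obtain l x where s: "spectral d A {..<d} l x" using herm_spectral[OF psd_herm[OF assms]] by blast
  then show thesis using that spectral_psd_iff[OF s] assms by blast
qed

lemma spectral_trace: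
  assumes "spectral d A J l x"
  shows "mtrace A = of_real (\<Sum>j\<in>J. l j)"
proof -
  have "mtrace A = (\<Sum>a<d. \<Sum>j\<in>J. of_real (l j) * (cnj (x j a) * x j a))"
    using assms by (auto simp: mtrace_def spectral_def ac_simps)
  also have "\<dots> = (\<Sum>j\<in>J. of_real (l j) * ip d (x j) (x j))"
    by (subst sum.swap) (simp add: ip_def sum_distrib_left)
  also have "\<dots> = (\<Sum>j\<in>J. of_real (l j))"
    using assms by (intro sum.cong refl) (simp add: spectral_def orthonormal_basis_def)
  finally show ?thesis by simp
qed

lemma mult_mat_entry:
  assumes "A \<in> carrier_mat d d" "B \<in> carrier_mat d d" "a < d" "b < d"
  shows "(A * B) $$ (a,b) = (\<Sum>c<d. A $$ (a,c) * B $$ (c,b))"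
  using assms by (simp add: scalar_prod_def atLeast0LessThan)

lemma mv_mult:
  assumes "A \<in> carrier_mat d d" "B \<in> carrier_mat d d" "a < d"
  shows "mv d (A * B) v a = mv d A (mv d B v) a"
  unfolding mv_def sum_distrib_left using assms
  by (subst sum.swap) (simp add: mult_mat_entry sum_distrib_right mult.assoc del: index_mult_mat)

lemma spectral_square:
  assumes "spectral d A J l x"
  shows "spectral d (A * A) J (\<lambda>j. (l j)\<^sup>2) x"
proof (rule spectral_from_eigenvectors)
  have A: "A \<in> carrier_mat d d" using assms by (simp add: spectral_def)
  then show "A * A \<in> carrier_mat d d" by simp
  fix j a assume ja: "j \<in> J" "a < d"
  have "mv d A (mv d A (x j)) a = mv d A (\<lambda>a. of_real (l j) * x j a) a"
    using spectral_eigenvector[OF assms ja(1)] by (simp add: mv_def[of d A "mv d A (x j)"] mv_def[of d A "\<lambda>a. of_real (l j) * x j a"])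
  also have "\<dots> = of_real (l j) * mv d A (x j) a" by (simp add: mv_def sum_distrib_left ac_simps)
  finally show "mv d (A * A) (x j) a = of_real ((l j)\<^sup>2) * x j a"
    using mv_mult[OF A A ja(2)] spectral_eigenvector[OF assms ja] by (simp add: power2_eq_square)
qed (use assms in \<open>simp add: spectral_def\<close>)

lemma psd_sqrt:
  assumes "psd d A"
  obtains S where "psd d S" "A = S * S"
proof -
  obtain l x where s: "spectral d A {..<d} l x" and l: "\<And>j. j < d \<Longrightarrow> 0 \<le> l j"
    using psd_spectral[OF assms] by blast
  define S where "S = mat d d (\<lambda>(a,b). \<Sum>j<d. of_real (sqrt (l j)) * x j a * cnj (x j b))"
  have S: "spectral d S {..<d} (\<lambda>j. sqrt (l j)) x"
    using s by (auto simp: spectral_def S_def)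
  have "A = S * S"
  proof (rule eq_matI)
    fix a b assume "a < dim_row (S * S)" "b < dim_col (S * S)"
    then have "a < d" "b < d" by (auto simp: S_def)
    then show "A $$ (a,b) = (S * S) $$ (a,b)"
      using spectral_square[OF S] s l by (auto simp: spectral_def intro!: sum.cong)
  qed (use s in \<open>auto simp: spectral_def S_def\<close>)
  moreover have "psd d S" using spectral_psd_iff[OF S] l by simp
  ultimately show thesis using that by blast
qed

text \<open>Expanding both decompositions leaves the squared overlaps of the eigenbases as weights.
  They become the matrix P of the Nussbaum-Szkola distributions, and for nonnegative eigenvalues
  they make the pairing nonnegative.\<close>

lemma spectral_hs:
  assumes "spectral d A J l x" "spectral d B K m y"
  shows "hs d A B = of_real (\<Sum>j\<in>J. \<Sum>k\<in>K. l j * m k * (cmod (ip d (x j) (y k)))\<^sup>2)"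
proof -
  have "hs d A B = (\<Sum>a<d. \<Sum>b<d. \<Sum>j\<in>J. of_real (l j) * x j a * cnj (x j b) * cnj (B $$ (a,b)))"
    using assms(1) by (simp add: hs_def spectral_def sum_distrib_right)
  also have "\<dots> = (\<Sum>a<d. \<Sum>j\<in>J. \<Sum>b<d. of_real (l j) * x j a * cnj (x j b) * cnj (B $$ (a,b)))"
    by (intro sum.cong refl sum.swap)
  also have "\<dots> = (\<Sum>j\<in>J. \<Sum>a<d. \<Sum>b<d. of_real (l j) * x j a * cnj (x j b) * cnj (B $$ (a,b)))"
    by (rule sum.swap)
  also have "\<dots> = (\<Sum>j\<in>J. of_real (l j) * cnj (ip d (x j) (mv d B (x j))))"
    by (simp add: ip_def mv_def sum_distrib_left ac_simps)
  also have "\<dots> = (\<Sum>j\<in>J. of_real (l j) * of_real (\<Sum>k\<in>K. m k * (cmod (ip d (y k) (x j)))\<^sup>2))"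
    unfolding spectral_ip_mv[OF assms(2)] by simp
  also have "\<dots> = of_real (\<Sum>j\<in>J. \<Sum>k\<in>K. l j * m k * (cmod (ip d (y k) (x j)))\<^sup>2)"
    by (simp add: sum_distrib_left mult.assoc)
  also have "(\<lambda>j k. cmod (ip d (y k) (x j))) = (\<lambda>j k. cmod (ip d (x j) (y k)))"
    by (metis cnj_ip complex_mod_cnj)
  finally show ?thesis by metis
qed

lemma hs_psd_nonneg:
  assumes "psd d A" "psd d B"
  shows "0 \<le> Re (hs d A B)"
proof -
  obtain l x where s: "spectral d A {..<d} l x" and l: "\<And>j. j < d \<Longrightarrow> 0 \<le> l j"
    using psd_spectral[OF assms(1)] by blast
  obtain m y where t: "spectral d B {..<d} m y" and m: "\<And>j. j < d \<Longrightarrow> 0 \<le> m j"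
    using psd_spectral[OF assms(2)] by blast
  show ?thesis unfolding spectral_hs[OF s t] using l m by (auto intro!: sum_nonneg)
qed

lemma hs_trace:
  assumes "herm d A" "herm d B"
  shows "hs d A B = mtrace (A * B)"
proof -
  have A: "A \<in> carrier_mat d d" and B: "B \<in> carrier_mat d d" using assms by (auto simp: herm_def)
  have "mtrace (A * B) = (\<Sum>a<d. (A * B) $$ (a,a))" using A by (simp add: mtrace_def)
  also have "\<dots> = (\<Sum>a<d. \<Sum>c<d. A $$ (a,c) * B $$ (c,a))"
    using mult_mat_entry[OF A B] by (intro sum.cong refl) auto
  also have "\<dots> = hs d A B" unfolding hs_def using hermD[OF assms(2)] by (intro sum.cong refl) auto
  finally show ?thesis ..
qed


section \<open>Kronecker products\<close>

lemma sum_div_mod: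
  fixes f :: "nat \<Rightarrow> nat \<Rightarrow> 'a::comm_monoid_add"
  shows "(\<Sum>i<m * n. f (i div n) (i mod n)) = (\<Sum>a<m. \<Sum>b<n. f a b)"
proof (cases "n = 0")
  case False
  have lt: "a * n + b < m * n" if "a < m" "b < n" for a b
    using mult_le_mono1[of "Suc a" m n] that by simp
  have "(\<Sum>a<m. \<Sum>b<n. f a b) = (\<Sum>(a,b)\<in>{..<m} \<times> {..<n}. f a b)"
    by (simp add: sum.cartesian_product)
  also have "\<dots> = (\<Sum>i<m * n. f (i div n) (i mod n))"
    using False
    by (intro sum.reindex_bij_witness[of _ "\<lambda>i. (i div n, i mod n)" "\<lambda>(a,b). a * n + b"])
       (auto simp: less_mult_imp_div_less lt)
  finally show ?thesis ..
qed simp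

lemma kron_carrier: "A \<in> carrier_mat d d \<Longrightarrow> B \<in> carrier_mat e e \<Longrightarrow> kron A B \<in> carrier_mat (d * e) (d * e)"
  by (auto simp: kron_def)

lemma div_mod_less:
  fixes i d e :: nat
  assumes "i < d * e" shows "i div e < d" "i mod e < e"
  using assms by (auto simp: less_mult_imp_div_less intro!: mod_less_divisor gr0I)

lemma kron_entry:
  assumes "A \<in> carrier_mat d d" "B \<in> carrier_mat e e" "i < d * e" "j < d * e"
  shows "kron A B $$ (i,j) = A $$ (i div e, j div e) * B $$ (i mod e, j mod e)"
  using assms by (simp add: kron_def)

lemma ip_kron: "ip (d * e) (\<lambda>a. u (a div e) * v (a mod e)) (\<lambda>a. u' (a div e) * v' (a mod e)) = ip d u u' * ip e v v'"
proof -
  have "ip (d * e) (\<lambda>a. u (a div e) * v (a mod e)) (\<lambda>a. u' (a div e) * v' (a mod e))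
     = (\<Sum>a<d. \<Sum>b<e. cnj (u a) * u' a * (cnj (v b) * v' b))"
    unfolding ip_def sum_div_mod[symmetric] by (simp add: ac_simps)
  then show ?thesis by (simp add: ip_def sum_product)
qed

lemma spectral_kron:
  assumes "spectral d A J l x" "spectral e B K m y"
  shows "spectral (d * e) (kron A B) (J \<times> K) (\<lambda>(j,k). l j * m k) (\<lambda>(j,k) a. x j (a div e) * y k (a mod e))"
  unfolding spectral_def orthonormal_basis_def
proof (intro conjI ballI allI impI)
  have A: "A \<in> carrier_mat d d" "B \<in> carrier_mat e e" using assms by (auto simp: spectral_def)
  show "kron A B \<in> carrier_mat (d * e) (d * e)" using kron_carrier[OF A] .
  show "finite (J \<times> K)" "card (J \<times> K) = d * e"
    using assms by (auto simp: spectral_def orthonormal_basis_def card_cartesian_product)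
  fix p q assume "p \<in> J \<times> K" "q \<in> J \<times> K"
  then show "ip (d * e) ((\<lambda>(j,k) a. x j (a div e) * y k (a mod e)) p) ((\<lambda>(j,k) a. x j (a div e) * y k (a mod e)) q)
      = of_bool (p = q)"
    using assms by (auto simp: spectral_def orthonormal_basis_def ip_kron split: prod.splits)
next
  fix a b assume ab: "a < d * e" "b < d * e"
  have A: "A \<in> carrier_mat d d" "B \<in> carrier_mat e e" using assms by (auto simp: spectral_def)
  have "kron A B $$ (a,b) = A $$ (a div e, b div e) * B $$ (a mod e, b mod e)"
    by (rule kron_entry[OF A ab])
  also have "\<dots> = (\<Sum>j\<in>J. of_real (l j) * x j (a div e) * cnj (x j (b div e))) *
     (\<Sum>k\<in>K. of_real (m k) * y k (a mod e) * cnj (y k (b mod e)))"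
    using assms div_mod_less[OF ab(1)] div_mod_less[OF ab(2)] by (simp add: spectral_def)
  also have "\<dots> = (\<Sum>(j,k)\<in>J \<times> K. of_real (l j * m k) * (x j (a div e) * y k (a mod e)) * cnj (x j (b div e) * y k (b mod e)))"
    unfolding sum_product sum.cartesian_product by (intro sum.cong refl) (auto simp: ac_simps)
  finally show "kron A B $$ (a,b) = (\<Sum>j\<in>J \<times> K. of_real ((\<lambda>(j,k). l j * m k) j) *
      (\<lambda>(j,k) a. x j (a div e) * y k (a mod e)) j a * cnj ((\<lambda>(j,k) a. x j (a div e) * y k (a mod e)) j b))"
    by (simp add: case_prod_unfold)
qed

lemma psd_kron:
  assumes "psd d A" "psd e B"
  shows "psd (d * e) (kron A B)"
proof -
  obtain l x where s: "spectral d A {..<d} l x" and l: "\<And>j. j < d \<Longrightarrow> 0 \<le> l j"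
    using psd_spectral[OF assms(1)] by blast
  obtain m y where t: "spectral e B {..<e} m y" and m: "\<And>j. j < e \<Longrightarrow> 0 \<le> m j"
    using psd_spectral[OF assms(2)] by blast
  show ?thesis unfolding spectral_psd_iff[OF spectral_kron[OF s t]] using l m by auto
qed

text \<open>Makes the Kronecker product of square roots a square root of the Kronecker
  product.\<close>

lemma kron_mult_kron:
  assumes "A \<in> carrier_mat d d" "C \<in> carrier_mat d d" "B \<in> carrier_mat e e" "D \<in> carrier_mat e e"
  shows "kron A B * kron C D = kron (A * C) (B * D)"
proof (rule eq_matI)
  have c: "A * C \<in> carrier_mat d d" "B * D \<in> carrier_mat e e" using assms by auto
  fix i j assume "i < dim_row (kron (A * C) (B * D))" "j < dim_col (kron (A * C) (B * D))"
  then have ij: "i < d * e" "j < d * e" using assms by (auto simp: kron_def)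
  have "(kron A B * kron C D) $$ (i,j) = (\<Sum>k<d * e. kron A B $$ (i,k) * kron C D $$ (k,j))"
    by (rule mult_mat_entry[OF kron_carrier kron_carrier ij]) (use assms in auto)
  also have "\<dots> = (\<Sum>k<d * e. (A $$ (i div e, k div e) * C $$ (k div e, j div e)) *
      (B $$ (i mod e, k mod e) * D $$ (k mod e, j mod e)))"
    using ij assms by (intro sum.cong refl) (simp add: kron_entry ac_simps)
  also have "\<dots> = (\<Sum>a<d. \<Sum>b<e. (A $$ (i div e, a) * C $$ (a, j div e)) *
      (B $$ (i mod e, b) * D $$ (b, j mod e)))"
    by (rule sum_div_mod)
  also have "\<dots> = (A * C) $$ (i div e, j div e) * (B * D) $$ (i mod e, j mod e)"
    using assms div_mod_less[OF ij(1)] div_mod_less[OF ij(2)]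
    by (subst (1 2) mult_mat_entry) (auto simp: sum_product)
  finally show "(kron A B * kron C D) $$ (i,j) = kron (A * C) (B * D) $$ (i,j)"
    using kron_entry[OF c ij] by simp
qed (use assms in \<open>auto simp: kron_def\<close>)

lemma hs_kron:
  assumes "A \<in> carrier_mat d d" "C \<in> carrier_mat d d" "B \<in> carrier_mat e e" "D \<in> carrier_mat e e"
  shows "hs (d * e) (kron A B) (kron C D) = hs d A C * hs e B D"
proof -
  have "hs (d * e) (kron A B) (kron C D) = (\<Sum>i<d * e. \<Sum>j<d * e.
      (A $$ (i div e, j div e) * cnj (C $$ (i div e, j div e))) *
      (B $$ (i mod e, j mod e) * cnj (D $$ (i mod e, j mod e))))"
    unfolding hs_def using assms by (intro sum.cong refl) (simp add: kron_entry ac_simps)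
  also have "\<dots> = (\<Sum>a<d. \<Sum>b<e. \<Sum>a'<d. \<Sum>b'<e.
      (A $$ (a, a') * cnj (C $$ (a, a'))) * (B $$ (b, b') * cnj (D $$ (b, b'))))"
    by (simp add: sum_div_mod[of "\<lambda>a b. (A $$ (_, a) * cnj (C $$ (_, a))) * (B $$ (_, b) * cnj (D $$ (_, b)))"]
        sum_div_mod[of "\<lambda>i i'. \<Sum>a<d. \<Sum>b<e. (A $$ (i, a) * cnj (C $$ (i, a))) * (B $$ (i', b) * cnj (D $$ (i', b)))"])
  also have "\<dots> = hs d A C * hs e B D"
    unfolding hs_def by (simp add: sum_product)
  finally show ?thesis .
qed

lemma mtrace_kron:
  assumes "A \<in> carrier_mat d d" "B \<in> carrier_mat e e"
  shows "mtrace (kron A B) = mtrace A * mtrace B"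
proof -
  have "mtrace (kron A B) = (\<Sum>i<d * e. A $$ (i div e, i div e) * B $$ (i mod e, i mod e))"
    using kron_entry[OF assms] kron_carrier[OF assms] by (simp add: mtrace_def)
  also have "\<dots> = (\<Sum>a<d. \<Sum>b<e. A $$ (a,a) * B $$ (b,b))" by (rule sum_div_mod)
  finally show ?thesis using assms by (simp add: mtrace_def sum_product)
qed

text \<open>The product rule for x log x covers zeros too, as both sides vanish there; summed over a
  product spectrum it gives additivity of entropy.\<close>

lemma xlogx_mult: "0 \<le> a \<Longrightarrow> 0 \<le> b \<Longrightarrow> xlogx (a * b) = b * xlogx a + a * xlogx b"
  by (auto simp: xlogx_def log_mult algebra_simps mult_le_0_iff zero_less_mult_iff not_le)

lemma vn_entropy_kron:
  assumes "psd d A" "psd e B" "mtrace A = 1" "mtrace B = 1"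
  shows "vn_entropy (kron A B) = vn_entropy A + vn_entropy B"
proof -
  obtain l x where s: "spectral d A {..<d} l x" and l: "\<And>j. j < d \<Longrightarrow> 0 \<le> l j"
    using psd_spectral[OF assms(1)] by blast
  obtain m y where t: "spectral e B {..<e} m y" and m: "\<And>j. j < e \<Longrightarrow> 0 \<le> m j"
    using psd_spectral[OF assms(2)] by blast
  have tr: "(\<Sum>j<d. l j) = 1" "(\<Sum>k<e. m k) = 1"
    using spectral_trace[OF s] spectral_trace[OF t] assms(3,4) by (metis of_real_eq_1_iff)+
  have "vn_entropy (kron A B) = - (\<Sum>j<d. \<Sum>k<e. xlogx (l j * m k))"
    unfolding spectral_vn_entropy[OF spectral_kron[OF s t]]
    by (simp add: sum.cartesian_product case_prod_unfold)
  also have "(\<Sum>j<d. \<Sum>k<e. xlogx (l j * m k)) = (\<Sum>j<d. \<Sum>k<e. xlogx (l j) * m k + l j * xlogx (m k))"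
    using l m by (intro sum.cong refl) (simp add: xlogx_mult)
  also have "\<dots> = (\<Sum>j<d. xlogx (l j)) * (\<Sum>k<e. m k) + (\<Sum>j<d. l j) * (\<Sum>k<e. xlogx (m k))"
    by (simp add: sum.distrib sum_product)
  finally show ?thesis
    by (simp add: tr spectral_vn_entropy[OF s] spectral_vn_entropy[OF t])
qed


section \<open>Entropic inequalities for overlap distributions\<close>

text \<open>The distributions \<open>P i k * (r i)\<^sup>2\<close> and \<open>P i k * (g k)\<^sup>2\<close> arise from states
  \<open>\<Sum>i (r i)\<^sup>2 |x\<^sub>i\<rangle>\<langle>x\<^sub>i|\<close> and \<open>\<Sum>k (g k)\<^sup>2 |w\<^sub>k\<rangle>\<langle>w\<^sub>k|\<close> with \<open>P i k = |\<langle>x\<^sub>i, w\<^sub>k\<rangle>|\<^sup>2\<close>.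
  Then \<open>D\<close> is the quantum relative entropy of the two states and \<open>t\<close> is the trace of the product
  of their square roots. Both \<open>log 2 0\<close> and \<open>x / 0\<close> are \<open>0\<close>; by the support condition
  such terms only occur with weight \<open>0\<close>.\<close>

locale nussbaum_szkola =
  fixes I :: "'i set" and K :: "'k set" and P :: "'i \<Rightarrow> 'k \<Rightarrow> real" and r :: "'i \<Rightarrow> real" and g :: "'k \<Rightarrow> real"
  assumes fin: "finite I" "finite K"
    and P_nonneg: "\<And>i k. i \<in> I \<Longrightarrow> k \<in> K \<Longrightarrow> 0 \<le> P i k"
    and P_row: "\<And>i. i \<in> I \<Longrightarrow> (\<Sum>k\<in>K. P i k) = 1"
    and P_col: "\<And>k. k \<in> K \<Longrightarrow> (\<Sum>i\<in>I. P i k) = 1"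
    and r_nonneg: "\<And>i. i \<in> I \<Longrightarrow> 0 \<le> r i"
    and g_nonneg: "\<And>k. k \<in> K \<Longrightarrow> 0 \<le> g k"
    and r_sum: "(\<Sum>i\<in>I. (r i)\<^sup>2) = 1"
    and g_sum: "(\<Sum>k\<in>K. (g k)\<^sup>2) = 1"
    and support: "\<And>i k. i \<in> I \<Longrightarrow> k \<in> K \<Longrightarrow> g k = 0 \<Longrightarrow> r i * P i k = 0"
    and dominated: "\<And>i. i \<in> I \<Longrightarrow> (r i)\<^sup>2 * (\<Sum>k\<in>K. P i k / (g k)\<^sup>2) \<le> 2"
begin

definition D :: real where
  "D = (\<Sum>i\<in>I. \<Sum>k\<in>K. P i k * ((r i)\<^sup>2 * (2 * log 2 (r i) - 2 * log 2 (g k))))"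

definition t :: real where
  "t = (\<Sum>i\<in>I. \<Sum>k\<in>K. P i k * (r i * g k))"

lemma sum_r: "(\<Sum>i\<in>I. \<Sum>k\<in>K. P i k * (r i)\<^sup>2) = 1"
proof -
  have "(\<Sum>i\<in>I. \<Sum>k\<in>K. P i k * (r i)\<^sup>2) = (\<Sum>i\<in>I. (r i)\<^sup>2)"
    using P_row by (simp flip: sum_distrib_right)
  then show ?thesis by (simp add: r_sum)
qed

lemma sum_g: "(\<Sum>i\<in>I. \<Sum>k\<in>K. P i k * (g k)\<^sup>2) = 1"
proof -
  have "(\<Sum>i\<in>I. \<Sum>k\<in>K. P i k * (g k)\<^sup>2) = (\<Sum>k\<in>K. \<Sum>i\<in>I. P i k * (g k)\<^sup>2)"
    by (rule sum.swap)
  also have "\<dots> = (\<Sum>k\<in>K. (g k)\<^sup>2)"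
    using P_col by (simp flip: sum_distrib_right)
  finally show ?thesis by (simp add: g_sum)
qed

text \<open>A chi-square bound. \<open>dominated\<close> says that the inverse of the second state,
  evaluated in an eigenvector of the first, is at most 2 over the eigenvalue; this is the form in
  which domination by twice the average state enters.\<close>

lemma sum_quotient: "(\<Sum>i\<in>I. \<Sum>k\<in>K. P i k * ((r i)\<^sup>2 * (r i)\<^sup>2 / (g k)\<^sup>2)) \<le> 2"
proof -
  have "(\<Sum>i\<in>I. \<Sum>k\<in>K. P i k * ((r i)\<^sup>2 * (r i)\<^sup>2 / (g k)\<^sup>2))
      = (\<Sum>i\<in>I. (r i)\<^sup>2 * ((r i)\<^sup>2 * (\<Sum>k\<in>K. P i k / (g k)\<^sup>2)))"
    by (simp add: sum_distrib_left ac_simps)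
  also have "\<dots> \<le> (\<Sum>i\<in>I. (r i)\<^sup>2 * 2)"
    using dominated by (intro sum_mono mult_left_mono) auto
  finally show ?thesis by (simp add: r_sum flip: sum_distrib_right)
qed

lemma t_le_1: "t \<le> 1"
proof -
  have "t \<le> (\<Sum>i\<in>I. \<Sum>k\<in>K. P i k * (r i)\<^sup>2 / 2 + P i k * (g k)\<^sup>2 / 2)"
    unfolding t_def
  proof (intro sum_mono)
    fix i k assume "i \<in> I" "k \<in> K"
    then show "P i k * (r i * g k) \<le> P i k * (r i)\<^sup>2 / 2 + P i k * (g k)\<^sup>2 / 2"
      using mult_left_mono[OF sum_squares_bound[of "r i" "g k"] P_nonneg] by (simp add: field_simps)
  qed
  also have "\<dots> = 1"
    using sum_r sum_g by (simp add: sum.distrib flip: sum_divide_distrib)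
  finally show ?thesis .
qed

text \<open>\<open>ln z \<le> z - 1\<close> at \<open>z = g k / (r i * c)\<close>, averaged with the
  weights \<open>P i k * (r i)^2\<close>. As a function of t the bound is the tangent to
  \<open>- 2 * log 2 t\<close> at t = c; it is used with c = 1 and c = 1 / sqrt 2.\<close>

lemma D_ge:
  assumes "0 < c"
  shows "- 2 * log 2 c - 2 / ln 2 * (t / c - 1) \<le> D"
proof -
  have "- 2 * log 2 c - 2 / ln 2 * (t / c - 1) = (\<Sum>i\<in>I. \<Sum>k\<in>K.
      - 2 * log 2 c * (P i k * (r i)\<^sup>2) - 2 / (ln 2 * c) * (P i k * (r i * g k)) + 2 / ln 2 * (P i k * (r i)\<^sup>2))"
    unfolding sum.distrib sum_subtractf sum_distrib_left[symmetric] sum_r t_def[symmetric]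
    by (simp add: field_simps)
  also have "\<dots> \<le> D"
    unfolding D_def
  proof (intro sum_mono)
    fix i k assume ik: "i \<in> I" "k \<in> K"
    have "r i = 0 \<or> P i k = 0 \<or> (0 < r i \<and> 0 < g k)"
      using support[OF ik] r_nonneg[OF ik(1)] g_nonneg[OF ik(2)] by (auto simp: less_le)
    then consider "r i = 0 \<or> P i k = 0" | "0 < r i" "0 < g k" by blast
    then show "- 2 * log 2 c * (P i k * (r i)\<^sup>2) - 2 / (ln 2 * c) * (P i k * (r i * g k)) + 2 / ln 2 * (P i k * (r i)\<^sup>2)
      \<le> P i k * ((r i)\<^sup>2 * (2 * log 2 (r i) - 2 * log 2 (g k)))"
    proof cases
      case 2
      have "ln (g k / (r i * c)) \<le> g k / (r i * c) - 1"
        using 2 assms by (intro ln_le_minus_one) auto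
      then have "ln (g k) - ln (r i) - ln c \<le> g k / (r i * c) - 1"
        using 2 assms by (simp add: ln_div ln_mult)
      then have "(r i)\<^sup>2 * (ln (g k) - ln (r i) - ln c) \<le> (r i)\<^sup>2 * (g k / (r i * c) - 1)"
        by (intro mult_left_mono) auto
      also have "\<dots> = r i * g k / c - (r i)\<^sup>2"
        using 2 assms by (simp add: field_simps power2_eq_square)
      finally have "P i k * (2 / ln 2 * ((r i)\<^sup>2 * (ln (g k) - ln (r i) - ln c))) \<le> P i k * (2 / ln 2 * (r i * g k / c - (r i)\<^sup>2))"
        using P_nonneg[OF ik] by (intro mult_left_mono) auto
      then show ?thesis by (simp add: log_def field_simps)
    qed auto
  qed
  finally show ?thesis .
qed

lemma D_nonneg: "0 \<le> D"
proof -
  have "2 / ln 2 * (t - 1) \<le> 0" using t_le_1 by (intro mult_nonneg_nonpos) auto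
  then show ?thesis using D_ge[of 1] by simp
qed

text \<open>The same inequality for the inverse ratio \<open>z = r i / (c * g k)\<close>, which
  brings in the quotient that the domination controls.\<close>

lemma D_le:
  assumes "0 < c"
  shows "D \<le> 2 * log 2 c + 2 / ln 2 * (\<Sum>i\<in>I. \<Sum>k\<in>K. P i k * ((r i)\<^sup>2 * (r i / (c * g k) - 1)))"
proof -
  have "D \<le> (\<Sum>i\<in>I. \<Sum>k\<in>K. 2 * log 2 c * (P i k * (r i)\<^sup>2) + 2 / ln 2 * (P i k * ((r i)\<^sup>2 * (r i / (c * g k) - 1))))"
    unfolding D_def
  proof (intro sum_mono)
    fix i k assume ik: "i \<in> I" "k \<in> K"
    have "r i = 0 \<or> P i k = 0 \<or> (0 < r i \<and> 0 < g k)"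
      using support[OF ik] r_nonneg[OF ik(1)] g_nonneg[OF ik(2)] by (auto simp: less_le)
    then consider "r i = 0 \<or> P i k = 0" | "0 < r i" "0 < g k" by blast
    then show "P i k * ((r i)\<^sup>2 * (2 * log 2 (r i) - 2 * log 2 (g k)))
       \<le> 2 * log 2 c * (P i k * (r i)\<^sup>2) + 2 / ln 2 * (P i k * ((r i)\<^sup>2 * (r i / (c * g k) - 1)))"
    proof cases
      case 2
      have "ln (r i / (c * g k)) \<le> r i / (c * g k) - 1"
        using 2 assms by (intro ln_le_minus_one) auto
      then have "ln (r i) - ln c - ln (g k) \<le> r i / (c * g k) - 1"
        using 2 assms by (simp add: ln_div ln_mult)
      then have "P i k * (r i)\<^sup>2 * (2 / ln 2) * (ln (r i) - ln c - ln (g k))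
          \<le> P i k * (r i)\<^sup>2 * (2 / ln 2) * (r i / (c * g k) - 1)"
        using P_nonneg[OF ik] by (intro mult_left_mono) auto
      then show ?thesis by (simp add: log_def algebra_simps add_divide_distrib diff_divide_distrib)
    qed auto
  qed
  also have "\<dots> = 2 * log 2 c + 2 / ln 2 * (\<Sum>i\<in>I. \<Sum>k\<in>K. P i k * ((r i)\<^sup>2 * (r i / (c * g k) - 1)))"
    unfolding sum.distrib sum_distrib_left[symmetric] sum_r by simp
  finally show ?thesis .
qed

text \<open>c = sqrt 2 because the mean of \<open>(r i / g k)^2\<close> is at most 2: AM-GM then
  bounds the mean of \<open>r i / (sqrt 2 * g k)\<close> by 1, and the leading term
  \<open>2 * log 2 c\<close> is exactly 1.\<close>

lemma D_le_1: "D \<le> 1"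
proof -
  let ?S = "\<Sum>i\<in>I. \<Sum>k\<in>K. P i k * ((r i)\<^sup>2 * (r i / (sqrt 2 * g k) - 1))"
  have "?S \<le> (\<Sum>i\<in>I. \<Sum>k\<in>K. P i k * ((r i)\<^sup>2 * (r i)\<^sup>2 / (g k)\<^sup>2) / 4 - P i k * (r i)\<^sup>2 / 2)"
  proof (intro sum_mono)
    fix i k assume ik: "i \<in> I" "k \<in> K"
    let ?x = "(r i)\<^sup>2 / (sqrt 2 * g k)"
    have aux: "a - x * 1 \<le> y / 4 - x / 2" if "2 * a \<le> x + y / 2" for a x y :: real
      using that by simp
    have "2 * (r i * ?x) \<le> (r i)\<^sup>2 + ?x\<^sup>2"
      using sum_squares_bound[of "r i" ?x] by (simp add: mult.assoc)
    also have "?x\<^sup>2 = (r i)\<^sup>2 * (r i)\<^sup>2 / (g k)\<^sup>2 / 2"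
      by (simp add: power_divide power_mult_distrib power2_eq_square[of "(r i)\<^sup>2"])
    also have "2 * (r i * ?x) = 2 * ((r i)\<^sup>2 * (r i / (sqrt 2 * g k)))"
      by simp
    finally have "(r i)\<^sup>2 * (r i / (sqrt 2 * g k) - 1) \<le> (r i)\<^sup>2 * (r i)\<^sup>2 / (g k)\<^sup>2 / 4 - (r i)\<^sup>2 / 2"
      unfolding right_diff_distrib by (rule aux)
    from mult_left_mono[OF this P_nonneg[OF ik]]
    show "P i k * ((r i)\<^sup>2 * (r i / (sqrt 2 * g k) - 1)) \<le> P i k * ((r i)\<^sup>2 * (r i)\<^sup>2 / (g k)\<^sup>2) / 4 - P i k * (r i)\<^sup>2 / 2"
      unfolding right_diff_distrib by (simp only: times_divide_eq_right)
  qed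
  also have "\<dots> \<le> 0"
    unfolding sum_subtractf sum_divide_distrib[symmetric] sum_r using sum_quotient by simp
  finally have "2 / ln 2 * ?S \<le> 0" by (intro mult_nonneg_nonpos) auto
  moreover have "2 * log 2 (sqrt 2) = (1::real)" by (simp add: log_def ln_sqrt)
  ultimately show ?thesis using D_le[of "sqrt 2"] by simp
qed

text \<open>At c = 1 the excess is the sum of \<open>P * (r^2 / g) * (r - g)\<close>. Young's
  inequality with parameter \<epsilon> splits it into the quotient sum, at most 2, and the Hellinger
  sum of \<open>P * (r - g)^2\<close>, which is \<open>2 - 2 * t\<close>.\<close>

lemma D_le_t:
  assumes "0 < \<epsilon>"
  shows "D \<le> 2 / ln 2 * (\<epsilon> + (1 - t) / \<epsilon>)"
proof -
  let ?S = "\<Sum>i\<in>I. \<Sum>k\<in>K. P i k * ((r i)\<^sup>2 * (r i / (1 * g k) - 1))"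
  have "?S \<le> (\<Sum>i\<in>I. \<Sum>k\<in>K. \<epsilon> / 2 * (P i k * ((r i)\<^sup>2 * (r i)\<^sup>2 / (g k)\<^sup>2)) +
      1 / (2 * \<epsilon>) * (P i k * (r i)\<^sup>2 + P i k * (g k)\<^sup>2 - 2 * (P i k * (r i * g k))))"
  proof (intro sum_mono)
    fix i k assume ik: "i \<in> I" "k \<in> K"
    have "r i = 0 \<or> P i k = 0 \<or> (0 < r i \<and> 0 < g k)"
      using support[OF ik] r_nonneg[OF ik(1)] g_nonneg[OF ik(2)] by (auto simp: less_le)
    then consider "P i k = 0" | "r i = 0" | "0 < r i" "0 < g k" by blast
    then show "P i k * ((r i)\<^sup>2 * (r i / (1 * g k) - 1)) \<le> \<epsilon> / 2 * (P i k * ((r i)\<^sup>2 * (r i)\<^sup>2 / (g k)\<^sup>2)) +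
      1 / (2 * \<epsilon>) * (P i k * (r i)\<^sup>2 + P i k * (g k)\<^sup>2 - 2 * (P i k * (r i * g k)))"
    proof cases
      case 2
      then show ?thesis using assms P_nonneg[OF ik] by simp
    next
      case 3
      define x where "x = (r i)\<^sup>2 / g k"
      have "0 \<le> (\<epsilon> * x - (r i - g k))\<^sup>2 / (2 * \<epsilon>)" using assms by simp
      also have "\<dots> = \<epsilon> / 2 * x\<^sup>2 + 1 / (2 * \<epsilon>) * (r i - g k)\<^sup>2 - x * (r i - g k)"
        using assms by (simp add: field_simps power2_eq_square)
      finally have "x * (r i - g k) \<le> \<epsilon> / 2 * x\<^sup>2 + 1 / (2 * \<epsilon>) * (r i - g k)\<^sup>2" by simp
      from mult_left_mono[OF this P_nonneg[OF ik]]
      have "P i k * (x * (r i - g k)) \<le> \<epsilon> / 2 * (P i k * x\<^sup>2) + 1 / (2 * \<epsilon>) * (P i k * (r i - g k)\<^sup>2)"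
        by (simp add: distrib_left ac_simps)
      moreover have "x * (r i - g k) = (r i)\<^sup>2 * (r i / (1 * g k) - 1)"
        using 3 by (simp add: x_def field_simps)
      moreover have "x\<^sup>2 = (r i)\<^sup>2 * (r i)\<^sup>2 / (g k)\<^sup>2"
        by (simp add: x_def power_divide power2_eq_square[of "(r i)\<^sup>2"])
      moreover have "P i k * (r i - g k)\<^sup>2 = P i k * (r i)\<^sup>2 + P i k * (g k)\<^sup>2 - 2 * (P i k * (r i * g k))"
        by (simp add: power2_diff algebra_simps)
      ultimately show ?thesis by simp
    qed simp
  qed
  also have "\<dots> = \<epsilon> / 2 * (\<Sum>i\<in>I. \<Sum>k\<in>K. P i k * ((r i)\<^sup>2 * (r i)\<^sup>2 / (g k)\<^sup>2)) + 1 / (2 * \<epsilon>) * (1 + 1 - 2 * t)"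
    unfolding sum.distrib sum_subtractf sum_distrib_left[symmetric] sum_r sum_g t_def[symmetric] ..
  also have "\<dots> \<le> \<epsilon> / 2 * 2 + 1 / (2 * \<epsilon>) * (1 + 1 - 2 * t)"
    using sum_quotient assms by (intro add_right_mono mult_left_mono) auto
  also have "\<dots> = \<epsilon> + (1 - t) / \<epsilon>" using assms by (simp add: field_simps)
  finally have "2 / ln 2 * ?S \<le> 2 / ln 2 * (\<epsilon> + (1 - t) / \<epsilon>)" by (intro mult_left_mono) auto
  then show ?thesis using D_le[of 1] by simp
qed

end


section \<open>Bounds on the symmetric Holevo information\<close>

lemma mv_linear_combination:
  assumes "\<And>a b. a < d \<Longrightarrow> b < d \<Longrightarrow> A $$ (a,b) = (\<Sum>s\<in>S. of_real (c s) * B s $$ (a,b))" "a < d"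
  shows "mv d A v a = (\<Sum>s\<in>S. of_real (c s) * mv d (B s) v a)"
  unfolding mv_def sum_distrib_left using assms
  by (subst sum.swap) (simp add: sum_distrib_left sum_distrib_right ac_simps)

lemma ip_mv_linear_combination:
  assumes "\<And>a b. a < d \<Longrightarrow> b < d \<Longrightarrow> A $$ (a,b) = (\<Sum>s\<in>S. of_real (c s) * B s $$ (a,b))"
  shows "ip d u (mv d A v) = (\<Sum>s\<in>S. of_real (c s) * ip d u (mv d (B s) v))"
proof -
  have "ip d u (mv d A v) = ip d u (\<lambda>a. \<Sum>s\<in>S. of_real (c s) * mv d (B s) v a)"
    using mv_linear_combination[of d A c B S] assms by (intro ip_cong refl) blast
  then show ?thesis unfolding ip_sum_right .
qed

lemma psd_linear_combination:
  assumes "A \<in> carrier_mat d d" "\<And>s. s \<in> S \<Longrightarrow> psd d (B s)" "\<And>s. s \<in> S \<Longrightarrow> 0 \<le> c s"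
    and ent: "\<And>a b. a < d \<Longrightarrow> b < d \<Longrightarrow> A $$ (a,b) = (\<Sum>s\<in>S. of_real (c s) * B s $$ (a,b))"
  shows "psd d A"
  unfolding psd_def herm_def
proof (intro conjI allI impI)
  fix a b assume "a < d" "b < d"
  then show "A $$ (b,a) = cnj (A $$ (a,b))"
    using hermD[OF psd_herm[OF assms(2)]] by (simp add: ent)
next
  fix v
  have "ip d v (mv d A v) = (\<Sum>s\<in>S. of_real (c s) * ip d v (mv d (B s) v))"
    by (rule ip_mv_linear_combination) (rule ent)
  then show "0 \<le> Re (ip d v (mv d A v))"
    using assms(2,3) by (auto simp: psd_def intro!: sum_nonneg)
qed fact

lemma ip_mv_square:
  assumes "herm d A"
  shows "ip d v (mv d (A * A) v) = of_real (nrm2 d (mv d A v))"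
proof -
  have A: "A \<in> carrier_mat d d" using assms by (simp add: herm_def)
  have "ip d v (mv d (A * A) v) = ip d v (mv d A (mv d A v))"
    using mv_mult[OF A A] by (intro ip_cong) auto
  then show ?thesis by (simp only: herm_ip_mv[OF assms] ip_self)
qed

lemma spectral_nrm2_mv:
  assumes "spectral d A J l x"
  shows "nrm2 d (mv d A v) = (\<Sum>j\<in>J. (l j)\<^sup>2 * (cmod (ip d (x j) v))\<^sup>2)"
  using spectral_ip_mv[OF spectral_square[OF assms], of v] ip_mv_square[OF spectral_herm[OF assms], of v]
  by (metis of_real_eq_iff)

lemma psd_square: "herm d A \<Longrightarrow> psd d (A * A)"
  using herm_spectral spectral_square spectral_psd_iff by (metis zero_le_power2)

text \<open>If \<open>A - B\<close> had an eigenvector \<open>v\<close> with eigenvalue \<open>t < 0\<close>, then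
  \<open>0 \<le> \<parallel>A v\<parallel>\<^sup>2 - \<parallel>B v\<parallel>\<^sup>2 = t \<langle>v, (A + B) v\<rangle>\<close> would force \<open>\<langle>v, A v\<rangle> = \<langle>v, B v\<rangle> = 0\<close>.\<close>

lemma psd_diff_of_square_le:
  assumes A: "psd d A" and B: "psd d B"
    and le: "\<And>v. nrm2 d (mv d B v) \<le> nrm2 d (mv d A v)"
    and C: "C \<in> carrier_mat d d" "\<And>a b. a < d \<Longrightarrow> b < d \<Longrightarrow> C $$ (a,b) = A $$ (a,b) - B $$ (a,b)"
  shows "psd d C"
proof -
  have "herm d C"
    using C hermD[OF psd_herm[OF A]] hermD[OF psd_herm[OF B]] by (simp add: herm_def)
  then obtain l x where s: "spectral d C {..<d} l x" using herm_spectral by blast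
  have "0 \<le> l j" if j: "j < d" for j
  proof (rule ccontr)
    assume neg: "\<not> 0 \<le> l j"
    let ?v = "x j"
    have Cv: "mv d A ?v a - mv d B ?v a = of_real (l j) * ?v a" if "a < d" for a
      using spectral_eigenvector[OF s _ that, of j] j that
      by (simp add: mv_def C left_diff_distrib sum_subtractf)
    have eq: "ip d ?v (mv d A ?v) - ip d ?v (mv d B ?v) = of_real (l j)"
    proof -
      have "ip d ?v (mv d A ?v) - ip d ?v (mv d B ?v) = ip d ?v (\<lambda>a. mv d A ?v a - mv d B ?v a)"
        by (simp add: ip_def sum_subtractf right_diff_distrib)
      also have "\<dots> = ip d ?v (\<lambda>a. of_real (l j) * ?v a)" using Cv by (intro ip_cong) auto
      also have "\<dots> = of_real (l j) * ip d ?v ?v" by (simp add: ip_def sum_distrib_left ac_simps)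
      also have "ip d ?v ?v = 1" using s j by (simp add: spectral_def orthonormal_basis_def)
      finally show ?thesis by simp
    qed
    \<comment> \<open>The cross terms of <(A - B) v, (A + B) v> have the form z - cnj z and drop out
      of the real part.\<close>
    have "nrm2 d (mv d A ?v) - nrm2 d (mv d B ?v)
        = Re (ip d (\<lambda>a. mv d A ?v a - mv d B ?v a) (\<lambda>a. mv d A ?v a + mv d B ?v a))"
      unfolding nrm2_def ip_def Re_sum sum_subtractf[symmetric]
      by (intro sum.cong refl) (simp add: cmod_power2, simp add: power2_eq_square algebra_simps)
    also have "ip d (\<lambda>a. mv d A ?v a - mv d B ?v a) (\<lambda>a. mv d A ?v a + mv d B ?v a)
        = ip d (\<lambda>a. of_real (l j) * ?v a) (\<lambda>a. mv d A ?v a + mv d B ?v a)"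
      using Cv by (intro ip_cong) auto
    also have "\<dots> = of_real (l j) * (ip d ?v (mv d A ?v) + ip d ?v (mv d B ?v))"
      by (simp add: ip_def distrib_left sum.distrib sum_distrib_left ac_simps)
    finally have "0 \<le> l j * (Re (ip d ?v (mv d A ?v)) + Re (ip d ?v (mv d B ?v)))"
      using le[of ?v] by simp
    then have "Re (ip d ?v (mv d A ?v)) + Re (ip d ?v (mv d B ?v)) \<le> 0"
      using neg by (auto simp: zero_le_mult_iff)
    moreover have "0 \<le> Re (ip d ?v (mv d A ?v))" "0 \<le> Re (ip d ?v (mv d B ?v))"
      using A B by (auto simp: psd_def)
    moreover have "Re (ip d ?v (mv d A ?v)) - Re (ip d ?v (mv d B ?v)) = l j"
      using arg_cong[OF eq, of Re] by simp
    ultimately show False using neg by linarith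
  qed
  then show ?thesis using spectral_psd_iff[OF s] by simp
qed

lemma xlogx_square: "0 \<le> r \<Longrightarrow> xlogx (r\<^sup>2) = r\<^sup>2 * (2 * log 2 r)"
  by (auto simp: xlogx_def log_nat_power not_le)

text \<open>\<open>dom\<close> is the operator inequality between \<open>R * R\<close> and twice
  \<open>G * G\<close>, read as quadratic forms. Parseval in either basis gives the row and column
  sums of P; \<open>dom\<close> at an eigenvector in the kernel of G gives the support
  condition.\<close>

lemma spectral_nussbaum_szkola:
  assumes R: "psd d R" and G: "psd d G" and tr: "mtrace (R * R) = 1" "mtrace (G * G) = 1"
    and dom: "\<And>v. nrm2 d (mv d R v) \<le> 2 * nrm2 d (mv d G v)"
    and sR: "spectral d R {..<d} r x" and sG: "spectral d G {..<d} g w"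
  shows "nussbaum_szkola {..<d} {..<d} (\<lambda>i k. (cmod (ip d (x i) (w k)))\<^sup>2) r g"
proof
  have onx: "orthonormal_basis d {..<d} x" and onw: "orthonormal_basis d {..<d} w"
    using sR sG by (auto simp: spectral_def)
  have wx: "ip d (x i) (x i) = 1" "ip d (w i) (w i) = 1" if "i < d" for i
    using onx onw that by (auto simp: orthonormal_basis_def)
  have cm: "cmod (ip d u v) = cmod (ip d v u)" for u v by (metis cnj_ip complex_mod_cnj)
  note nR = spectral_nrm2_mv[OF sR]
  note nG = spectral_nrm2_mv[OF sG]
  have le: "(r i)\<^sup>2 * (cmod (ip d (x i) v))\<^sup>2 \<le> nrm2 d (mv d R v)" if "i < d" for i v
    unfolding nR using that by (intro member_le_sum[of i "{..<d}" "\<lambda>j. (r j)\<^sup>2 * (cmod (ip d (x j) v))\<^sup>2"]) auto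
  show "(\<Sum>k<d. (cmod (ip d (x i) (w k)))\<^sup>2) = 1" if "i \<in> {..<d}" for i
    using orthonormal_basis_parseval[OF onw, of "x i"] wx(1)[of i] that
    by (simp add: cm[of "x i"] ip_self)
  show "(\<Sum>i<d. (cmod (ip d (x i) (w k)))\<^sup>2) = 1" if "k \<in> {..<d}" for k
    using orthonormal_basis_parseval[OF onx, of "w k"] wx(2)[of k] that by (simp add: ip_self)
  show "0 \<le> r i" if "i \<in> {..<d}" for i using spectral_psd_iff[OF sR] R that by simp
  show "0 \<le> g i" if "i \<in> {..<d}" for i using spectral_psd_iff[OF sG] G that by simp
  show "(\<Sum>i<d. (r i)\<^sup>2) = 1"
    using spectral_trace[OF spectral_square[OF sR]] tr by (metis of_real_eq_1_iff)
  show "(\<Sum>i<d. (g i)\<^sup>2) = 1"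
    using spectral_trace[OF spectral_square[OF sG]] tr by (metis of_real_eq_1_iff)
  show "r i * (cmod (ip d (x i) (w k)))\<^sup>2 = 0" if ik: "i \<in> {..<d}" "k \<in> {..<d}" and "g k = 0" for i k
  proof -
    have "nrm2 d (mv d G (w k)) = (\<Sum>j<d. (g j)\<^sup>2 * (cmod (of_bool (j = k)))\<^sup>2)"
      unfolding nG using onw ik by (intro sum.cong refl) (simp add: orthonormal_basis_def)
    also have "\<dots> = 0" using \<open>g k = 0\<close> by (intro sum.neutral) auto
    finally have "(r i)\<^sup>2 * (cmod (ip d (x i) (w k)))\<^sup>2 \<le> 0"
      using le[of i "w k"] dom[of "w k"] ik by simp
    then show ?thesis by (auto simp: mult_le_0_iff)
  qed
  show "(r i)\<^sup>2 * (\<Sum>k<d. (cmod (ip d (x i) (w k)))\<^sup>2 / (g k)\<^sup>2) \<le> 2" if i: "i \<in> {..<d}" for i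
  proof -
    let ?s = "\<Sum>k<d. (cmod (ip d (x i) (w k)))\<^sup>2 / (g k)\<^sup>2"
    \<comment> \<open>v is the pseudo-inverse of \<open>G * G\<close> applied to \<open>x i\<close>;
      division by 0 discards the kernel of G. Then \<open>ip d (x i) v\<close> and
      \<open>nrm2 d (mv d G v)\<close> are the same sum s, and \<open>dom\<close> at v gives r^2 s^2
      \<le> 2 s.\<close>
    define v where "v = (\<lambda>a. \<Sum>k<d. of_real (1 / (g k)\<^sup>2) * ip d (w k) (x i) * w k a)"
    have xv: "ip d (x i) v = of_real ?s"
    proof -
      have "ip d (x i) v = (\<Sum>k<d. of_real (1 / (g k)\<^sup>2) * (ip d (x i) (w k) * cnj (ip d (x i) (w k))))"
        unfolding v_def ip_sum_right cnj_ip by (simp add: ac_simps)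
      also have "\<dots> = (\<Sum>k<d. of_real (1 / (g k)\<^sup>2 * (cmod (ip d (x i) (w k)))\<^sup>2))"
        by (simp only: complex_norm_square[symmetric] of_real_mult)
      finally show ?thesis by simp
    qed
    have wv: "ip d (w k) v = of_real (1 / (g k)\<^sup>2) * ip d (w k) (x i)" if "k < d" for k
    proof -
      have "ip d (w k) v = (\<Sum>k'<d. of_real (1 / (g k')\<^sup>2) * ip d (w k') (x i) * of_bool (k = k'))"
        unfolding v_def ip_sum_right using onw that
        by (intro sum.cong refl) (simp add: orthonormal_basis_def)
      then show ?thesis using that by (simp add: of_bool_def if_distrib[of "(*) _"] cong: if_cong)
    qed
    have "nrm2 d (mv d G v) = ?s"
      unfolding nG
    proof (intro sum.cong refl)
      fix k assume "k \<in> {..<d}"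
      then show "(g k)\<^sup>2 * (cmod (ip d (w k) v))\<^sup>2 = (cmod (ip d (x i) (w k)))\<^sup>2 / (g k)\<^sup>2"
        by (simp add: wv norm_mult norm_divide norm_power power_divide cm[of "x i"] power2_eq_square)
    qed
    then have "(r i)\<^sup>2 * ?s\<^sup>2 \<le> 2 * ?s"
      using le[of i v] dom[of v] i unfolding xv norm_of_real power2_abs by simp
    moreover have "0 \<le> ?s" by (intro sum_nonneg) auto
    ultimately show ?thesis
      using mult_right_le_imp_le[of "(r i)\<^sup>2 * ?s" ?s 2]
      by (cases "?s = 0") (auto simp only: power2_eq_square[of ?s] mult.assoc less_le, simp)
  qed
qed auto

text \<open>If g and w diagonalise G, and \<rho> = \<open>R * R\<close>, \<omega> =
  \<open>G * G\<close>, the right side is Tr \<rho> log \<rho> - Tr \<rho> log \<omega>: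
  \<open>nrm2 d (mv d R (w k))\<close> is the k-th diagonal entry of \<rho> in the basis w.\<close>

lemma nussbaum_szkola_D:
  assumes "nussbaum_szkola {..<d} {..<d} (\<lambda>i k. (cmod (ip d (x i) (w k)))\<^sup>2) r g"
    and sR: "spectral d R {..<d} r x" and R: "psd d R"
  shows "nussbaum_szkola.D {..<d} {..<d} (\<lambda>i k. (cmod (ip d (x i) (w k)))\<^sup>2) r g =
     - vn_entropy (R * R) - (\<Sum>k<d. 2 * log 2 (g k) * nrm2 d (mv d R (w k)))"
proof -
  interpret nussbaum_szkola "{..<d}" "{..<d}" "\<lambda>i k. (cmod (ip d (x i) (w k)))\<^sup>2" r g by fact
  note nR = spectral_nrm2_mv[OF sR]
  have "D = (\<Sum>i<d. \<Sum>k<d. (cmod (ip d (x i) (w k)))\<^sup>2 * ((r i)\<^sup>2 * (2 * log 2 (r i))))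
      - (\<Sum>i<d. \<Sum>k<d. 2 * log 2 (g k) * ((r i)\<^sup>2 * (cmod (ip d (x i) (w k)))\<^sup>2))"
    unfolding D_def sum_subtractf[symmetric] by (intro sum.cong refl) (simp add: algebra_simps)
  also have "(\<Sum>i<d. \<Sum>k<d. (cmod (ip d (x i) (w k)))\<^sup>2 * ((r i)\<^sup>2 * (2 * log 2 (r i)))) =
      (\<Sum>i<d. (r i)\<^sup>2 * (2 * log 2 (r i)))"
    unfolding sum_distrib_right[symmetric] using P_row by simp
  also have "\<dots> = - vn_entropy (R * R)"
    unfolding spectral_vn_entropy[OF spectral_square[OF sR]] using r_nonneg by (simp add: xlogx_square)
  also have "(\<Sum>i<d. \<Sum>k<d. 2 * log 2 (g k) * ((r i)\<^sup>2 * (cmod (ip d (x i) (w k)))\<^sup>2))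
      = (\<Sum>k<d. 2 * log 2 (g k) * nrm2 d (mv d R (w k)))"
    unfolding nR sum_distrib_left by (rule sum.swap)
  finally show ?thesis .
qed

text \<open>The form is the squared Hilbert-Schmidt norm of \<alpha> A + \<beta> B + \<gamma> C;
  three matrices serve to compare G with \<open>(R False + R True) / sqrt 2\<close>.\<close>

lemma hs_quadratic_form_nonneg:
  "0 \<le> \<alpha>\<^sup>2 * Re (hs d A A) + \<beta>\<^sup>2 * Re (hs d B B) + \<gamma>\<^sup>2 * Re (hs d C C)
     + 2 * \<alpha> * \<beta> * Re (hs d A B) + 2 * \<alpha> * \<gamma> * Re (hs d A C) + 2 * \<beta> * \<gamma> * Re (hs d B C)"
proof -
  have "0 \<le> (\<Sum>a<d. \<Sum>b<d. (cmod (of_real \<alpha> * A $$ (a,b) + of_real \<beta> * B $$ (a,b) + of_real \<gamma> * C $$ (a,b)))\<^sup>2)"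
    by (intro sum_nonneg) auto
  also have "\<dots> = \<alpha>\<^sup>2 * Re (hs d A A) + \<beta>\<^sup>2 * Re (hs d B B) + \<gamma>\<^sup>2 * Re (hs d C C)
     + 2 * \<alpha> * \<beta> * Re (hs d A B) + 2 * \<alpha> * \<gamma> * Re (hs d A C) + 2 * \<beta> * \<gamma> * Re (hs d B C)"
    unfolding hs_def Re_sum sum_distrib_left sum.distrib[symmetric]
    by (intro sum.cong refl) (simp add: cmod_power2, simp add: power2_eq_square algebra_simps)
  finally show ?thesis .
qed

text \<open>The information is the mean of the relative entropies of the two outputs against their
  average \<omega>, each controlled by its t. The work lies in bounding
  \<open>t False + t True\<close> by q from both sides.\<close>

lemma holevo_bounds:
  fixes R :: "bool \<Rightarrow> complex mat"
  assumes R: "\<And>x. psd d (R x)" and tr: "\<And>x. mtrace (R x * R x) = 1"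
  defines "V \<equiv> \<lambda>x. R x * R x" and "q \<equiv> Re (hs d (R False) (R True))"
  shows "0 \<le> sym_info V" "sym_info V \<le> 1" "1 - q / ln 2 \<le> sym_info V"
    and "0 < \<epsilon> \<Longrightarrow> sym_info V \<le> 2 / ln 2 * (\<epsilon> + (1 - q) / (2 * \<epsilon>))"
proof -
  have car: "R x \<in> carrier_mat d d" "V x \<in> carrier_mat d d" for x
    using psd_carrier[OF R, of x] by (auto simp: V_def)
  define \<omega> where "\<omega> = (1/2::complex) \<cdot>\<^sub>m (V False + V True)"
  have \<omega>: "\<omega> \<in> carrier_mat d d" using car by (auto simp: \<omega>_def)
  have ent: "\<omega> $$ (a,b) = (\<Sum>x\<in>UNIV. of_real ((\<lambda>_. 1/2) x) * V x $$ (a,b))" if "a < d" "b < d" for a b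
    using that car[of False] car[of True] by (simp add: \<omega>_def UNIV_bool algebra_simps)
  have "psd d \<omega>"
    using \<omega> psd_square[OF psd_herm[OF R]] ent
    by (intro psd_linear_combination[of \<omega> d UNIV V "\<lambda>_. 1/2"]) (auto simp: V_def)
  then obtain G where G: "psd d G" "\<omega> = G * G" using psd_sqrt by blast
  have nG: "nrm2 d (mv d G v) = (nrm2 d (mv d (R False) v) + nrm2 d (mv d (R True) v)) / 2" for v
  proof -
    have "complex_of_real (nrm2 d (mv d G v)) = ip d v (mv d \<omega> v)"
      unfolding G(2) by (rule ip_mv_square[OF psd_herm[OF G(1)], symmetric])
    also have "\<dots> = (\<Sum>x\<in>UNIV. of_real ((\<lambda>_. 1/2) x) * ip d v (mv d (V x) v))"
      by (rule ip_mv_linear_combination) (rule ent)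
    also have "\<dots> = of_real ((nrm2 d (mv d (R False) v) + nrm2 d (mv d (R True) v)) / 2)"
      unfolding V_def ip_mv_square[OF psd_herm[OF R]] by (simp add: UNIV_bool algebra_simps)
    finally show ?thesis by (simp only: of_real_eq_iff)
  qed
  have dom: "nrm2 d (mv d (R x) v) \<le> 2 * nrm2 d (mv d G v)" for x v
    using nG[of v] nrm2_nonneg[of d "mv d (R False) v"] nrm2_nonneg[of d "mv d (R True) v"] by (cases x) auto
  have trG: "mtrace (G * G) = 1"
  proof -
    have "mtrace \<omega> = (\<Sum>a<d. (V False $$ (a,a) + V True $$ (a,a)) / 2)"
      using \<omega> by (simp add: mtrace_def ent UNIV_bool add_divide_distrib)
    also have "\<dots> = (mtrace (V False) + mtrace (V True)) / 2"
      using car(2)[THEN carrier_matD(1)] by (simp add: mtrace_def sum.distrib flip: sum_divide_distrib)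
    finally show ?thesis using tr by (simp add: G V_def)
  qed
  obtain g w where sG: "spectral d G {..<d} g w" using herm_spectral[OF psd_herm[OF G(1)]] by blast
  have "\<exists>r x. spectral d (R y) {..<d} r x" for y using herm_spectral[OF psd_herm[OF R]] .
  then obtain r x where sR: "\<And>y. spectral d (R y) {..<d} (r y) (x y)" by metis
  note ns = spectral_nussbaum_szkola[OF R G(1) tr trG dom sR sG]
  define D where "D y = nussbaum_szkola.D {..<d} {..<d} (\<lambda>i k. (cmod (ip d (x y i) (w k)))\<^sup>2) (r y) g" for y
  define t where "t y = Re (hs d (R y) G)" for y
  have t: "nussbaum_szkola.t {..<d} {..<d} (\<lambda>i k. (cmod (ip d (x y i) (w k)))\<^sup>2) (r y) g = t y" for y
    unfolding t_def spectral_hs[OF sR sG] nussbaum_szkola.t_def[OF ns] by (simp add: ac_simps)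
  have Dy: "D y = - vn_entropy (R y * R y) - (\<Sum>k<d. 2 * log 2 (g k) * nrm2 d (mv d (R y) (w k)))" for y
    unfolding D_def by (rule nussbaum_szkola_D[OF ns sR R])
  \<comment> \<open>The terms with \<open>log 2 (g k)\<close> are linear in the state, so they
    average to the entropy of \<omega>.\<close>
  have chi: "sym_info V = (D False + D True) / 2"
  proof -
    have "nrm2 d (mv d G (w k)) = (g k)\<^sup>2" if "k < d" for k
      using spectral_ip_mv_eigenvector[OF spectral_square[OF sG], of k] ip_mv_square[OF psd_herm[OF G(1)], of "w k"] that
      by (metis lessThan_iff of_real_eq_iff)
    then have "(\<Sum>k<d. 2 * log 2 (g k) * nrm2 d (mv d G (w k))) = - vn_entropy \<omega>"
      unfolding G(2) spectral_vn_entropy[OF spectral_square[OF sG]]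
      using spectral_psd_iff[OF sG] G(1) by (simp add: xlogx_square mult.commute)
    moreover have "(\<Sum>k<d. 2 * log 2 (g k) * nrm2 d (mv d (R False) (w k))) + (\<Sum>k<d. 2 * log 2 (g k) * nrm2 d (mv d (R True) (w k)))
      = 2 * (\<Sum>k<d. 2 * log 2 (g k) * nrm2 d (mv d G (w k)))"
      unfolding nG sum_distrib_left sum.distrib[symmetric] by (intro sum.cong refl) (simp add: algebra_simps)
    ultimately show ?thesis unfolding Dy sym_info_def \<omega>_def[symmetric] by (simp add: V_def field_simps)
  qed
  have hs1: "Re (hs d (R y) (R y)) = 1" for y
    using hs_trace[OF psd_herm[OF R] psd_herm[OF R], of y y] tr by simp
  have hsG: "Re (hs d G G) = 1" using hs_trace[OF psd_herm[OF G(1)] psd_herm[OF G(1)]] trG by simp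
  show "0 \<le> sym_info V"
    unfolding chi D_def using nussbaum_szkola.D_nonneg[OF ns] by (simp add: add_nonneg_nonneg)
  show "sym_info V \<le> 1"
    unfolding chi D_def using nussbaum_szkola.D_le_1[OF ns, of False] nussbaum_szkola.D_le_1[OF ns, of True] by simp
  show "1 - q / ln 2 \<le> sym_info V"
  proof -
    have "1 - 2 / ln 2 * (t y * sqrt 2 - 1) \<le> D y" for y
    proof -
      \<comment> \<open>1 / sqrt 2 is the value of t for orthogonal outputs, where the information
        is 1; the bound is tight there.\<close>
      have "- 2 * log 2 (1 / sqrt 2) = 1" by (simp add: log_def ln_div ln_sqrt)
      then show ?thesis using nussbaum_szkola.D_ge[OF ns, of "1 / sqrt 2" y] by (simp add: t D_def)
    qed
    from this[of False] this[of True]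
    have "((1 - 2 / ln 2 * (t False * sqrt 2 - 1)) + (1 - 2 / ln 2 * (t True * sqrt 2 - 1))) / 2 \<le> sym_info V"
      unfolding chi by (intro divide_right_mono add_mono) auto
    moreover have "1 - c * ((u + v) * s / 2 - 1) = ((1 - c * (u * s - 1)) + (1 - c * (v * s - 1))) / 2" for c u v s :: real
      by (simp add: field_simps)
    ultimately have "1 - 2 / ln 2 * ((t False + t True) * sqrt 2 / 2 - 1) \<le> sym_info V"
      by (simp only:)
    moreover have "(t False + t True) * sqrt 2 \<le> 2 + q"
      using hs_quadratic_form_nonneg[of "1 / sqrt 2" d "R False" "1 / sqrt 2" "R True" "-1" G]
      by (simp add: hs1 hsG q_def[symmetric] t_def[symmetric] power_divide real_div_sqrt algebra_simps flip: times_divide_eq_left)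
    then have "2 / ln 2 * ((t False + t True) * sqrt 2 / 2 - 1) \<le> 2 / ln 2 * (q / 2)"
      by (intro mult_left_mono) auto
    ultimately show ?thesis by simp
  qed
  show "sym_info V \<le> 2 / ln 2 * (\<epsilon> + (1 - q) / (2 * \<epsilon>))" if eps: "0 < \<epsilon>"
  proof -
    \<comment> \<open>M averages the square roots. Convexity of the squared norm gives |M v| \<le>
      |G v|, hence M \<le> G by monotonicity of the square root; pairing G - M with both
      \<open>R y\<close> yields \<open>1 + q \<le> t False + t True\<close>.\<close>
    define M where "M = mat d d (\<lambda>(a,b). (R False $$ (a,b) + R True $$ (a,b)) / 2)"
    define C where "C = mat d d (\<lambda>(a,b). G $$ (a,b) - M $$ (a,b))"
    have M: "M $$ (a,b) = (\<Sum>x\<in>UNIV. of_real ((\<lambda>_. 1/2) x) * R x $$ (a,b))" if "a < d" "b < d" for a b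
      using that by (simp add: M_def UNIV_bool add_divide_distrib)
    have psdM: "psd d M"
      by (rule psd_linear_combination[of M d UNIV R "\<lambda>_. 1/2"]) (use R M in \<open>auto simp: M_def\<close>)
    have "nrm2 d (mv d M v) \<le> nrm2 d (mv d G v)" for v
      unfolding nG unfolding nrm2_def sum.distrib[symmetric] sum_divide_distrib
    proof (intro sum_mono)
      fix a assume "a \<in> {..<d}"
      then have "mv d M v a = (mv d (R False) v a + mv d (R True) v a) / 2"
        using mv_linear_combination[of d M "\<lambda>_. 1/2" R UNIV, OF M]
        by (simp add: UNIV_bool add_divide_distrib)
      then have "(cmod (mv d M v a))\<^sup>2 = (cmod (mv d (R False) v a + mv d (R True) v a))\<^sup>2 / 4"
        by (simp only: norm_divide power_divide) simp
      also have "\<dots> \<le> (cmod (mv d (R False) v a) + cmod (mv d (R True) v a))\<^sup>2 / 4"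
        by (intro divide_right_mono power_mono norm_triangle_ineq) auto
      also have "\<dots> \<le> ((cmod (mv d (R False) v a))\<^sup>2 + (cmod (mv d (R True) v a))\<^sup>2) / 2"
        using sum_squares_bound[of "cmod (mv d (R False) v a)" "cmod (mv d (R True) v a)"]
        by (simp add: power2_sum)
      finally show "(cmod (mv d M v a))\<^sup>2 \<le> ((cmod (mv d (R False) v a))\<^sup>2 + (cmod (mv d (R True) v a))\<^sup>2) / 2" .
    qed
    then have psdC: "psd d C"
      by (rule psd_diff_of_square_le[OF G(1) psdM]) (auto simp: C_def)
    have hsC: "hs d (R y) C = hs d (R y) G - (hs d (R y) (R False) + hs d (R y) (R True)) / 2" for y
      unfolding hs_def sum.distrib[symmetric] sum_divide_distrib sum_subtractf[symmetric]
      by (intro sum.cong refl) (simp add: C_def M_def algebra_simps add_divide_distrib)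
    have sym: "Re (hs d (R True) (R False)) = q"
      unfolding q_def hs_def Re_sum by (intro sum.cong refl) (simp add: ac_simps)
    have "1 + q \<le> t False + t True"
      using hs_psd_nonneg[OF R psdC, of False] hs_psd_nonneg[OF R psdC, of True]
      by (simp add: hsC hs1 sym t_def q_def[symmetric])
    moreover have "1 - x / 2 \<le> (1 - y) / 2" if "1 + y \<le> x" for x y :: real
      using that by (simp add: field_simps)
    ultimately have "1 - (t False + t True) / 2 \<le> (1 - q) / 2" by blast
    then have "(1 - (t False + t True) / 2) / \<epsilon> \<le> ((1 - q) / 2) / \<epsilon>"
      using eps by (rule divide_right_mono[OF _ less_imp_le])
    then have "\<epsilon> + (1 - (t False + t True) / 2) / \<epsilon> \<le> \<epsilon> + (1 - q) / (2 * \<epsilon>)" by simp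
    then have t_le: "2 / ln 2 * (\<epsilon> + (1 - (t False + t True) / 2) / \<epsilon>) \<le> 2 / ln 2 * (\<epsilon> + (1 - q) / (2 * \<epsilon>))"
      by (intro mult_left_mono) auto
    have "D y \<le> 2 / ln 2 * (\<epsilon> + (1 - t y) / \<epsilon>)" for y
      using nussbaum_szkola.D_le_t[OF ns eps, of y] by (simp add: t D_def)
    from this[of False] this[of True]
    have "sym_info V \<le> (2 / ln 2 * (\<epsilon> + (1 - t False) / \<epsilon>) + 2 / ln 2 * (\<epsilon> + (1 - t True) / \<epsilon>)) / 2"
      unfolding chi by (intro divide_right_mono add_mono) auto
    moreover have "(c * (\<epsilon> + (1 - u) / \<epsilon>) + c * (\<epsilon> + (1 - v) / \<epsilon>)) / 2 = c * (\<epsilon> + (1 - (u + v) / 2) / \<epsilon>)" for c u v :: real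
      using eps by (simp add: field_simps)
    ultimately have "sym_info V \<le> 2 / ln 2 * (\<epsilon> + (1 - (t False + t True) / 2) / \<epsilon>)"
      by (simp only:)
    then show ?thesis using t_le by linarith
  qed
qed


section \<open>Polarization of a bounded martingale\<close>

lemma sum_pairs:
  fixes f :: "nat \<Rightarrow> 'a::comm_monoid_add"
  shows "(\<Sum>j=1..2 * m. f j) = (\<Sum>i=1..m. f (2 * i - 1) + f (2 * i))"
  by (induction m) (auto simp: ac_simps)

lemma card_filter_eq_sum: "finite A \<Longrightarrow> real (card {i \<in> A. P i}) = (\<Sum>i\<in>A. of_bool (P i))"
  by (simp add: of_bool_def sum.If_cases Int_def)

text \<open>\<open>Q n i q\<close> is a relation because q depends on a choice of square roots.
  Channel i has the children \<open>2 * i - 1\<close> (minus) and \<open>2 * i\<close>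
  (plus).\<close>

locale polarization_process =
  fixes I :: "nat \<Rightarrow> nat \<Rightarrow> real" and Q :: "nat \<Rightarrow> nat \<Rightarrow> real \<Rightarrow> bool"
  assumes I_range: "\<And>n i. i \<in> {1..2^n} \<Longrightarrow> 0 \<le> I n i \<and> I n i \<le> 1"
    and I_martingale: "\<And>n i. i \<in> {1..2^n} \<Longrightarrow> I (Suc n) (2 * i - 1) + I (Suc n) (2 * i) = 2 * I n i"
    and Q_ex: "\<And>n i. i \<in> {1..2^n} \<Longrightarrow> \<exists>q. Q n i q"
    and Q_square: "\<And>n i q. i \<in> {1..2^n} \<Longrightarrow> Q n i q \<Longrightarrow> Q (Suc n) (2 * i) (q\<^sup>2)"
    and Q_nonneg: "\<And>n i q. i \<in> {1..2^n} \<Longrightarrow> Q n i q \<Longrightarrow> 0 \<le> q"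
    and I_ge: "\<And>n i q. i \<in> {1..2^n} \<Longrightarrow> Q n i q \<Longrightarrow> 1 - q / ln 2 \<le> I n i"
    and I_le: "\<And>n i q \<epsilon>. i \<in> {1..2^n} \<Longrightarrow> Q n i q \<Longrightarrow> 0 < \<epsilon> \<Longrightarrow> I n i \<le> 2 / ln 2 * (\<epsilon> + (1 - q) / (2 * \<epsilon>))"
begin

lemma mean: "(\<Sum>i=1..2^n. I n i) = 2 ^ n * I 0 1"
proof (induction n)
  case (Suc n)
  have "(\<Sum>i=1..2 * 2^n. I (Suc n) i) = (\<Sum>i=1..2^n. 2 * I n i)"
    unfolding sum_pairs using I_martingale by (intro sum.cong) auto
  then show ?case using Suc by (simp flip: sum_distrib_left)
qed simp

definition second_moment :: "nat \<Rightarrow> real" where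
  "second_moment n = (\<Sum>i=1..2^n. (I n i)\<^sup>2) / 2 ^ n"

definition increment :: "nat \<Rightarrow> nat \<Rightarrow> real" where
  "increment n i = I (Suc n) (2 * i) - I n i"

text \<open>The children carry \<open>I n i\<close> minus and plus \<open>increment n i\<close>, so
  the cross terms of their squares cancel: martingale increments are orthogonal.\<close>

lemma second_moment_Suc:
  "second_moment (Suc n) - second_moment n = (\<Sum>i=1..2^n. (increment n i)\<^sup>2) / 2 ^ n"
proof -
  have "(\<Sum>i=1..2 * 2^n. (I (Suc n) i)\<^sup>2) = (\<Sum>i=1..2^n. 2 * (I n i)\<^sup>2 + 2 * (increment n i)\<^sup>2)"
    unfolding sum_pairs
  proof (intro sum.cong refl)
    fix i :: nat assume "i \<in> {1..2^n}"
    then have eq: "I (Suc n) (2 * i - 1) = 2 * I n i - I (Suc n) (2 * i)"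
      using I_martingale[of i n] by simp
    then show "(I (Suc n) (2 * i - 1))\<^sup>2 + (I (Suc n) (2 * i))\<^sup>2 = 2 * (I n i)\<^sup>2 + 2 * (increment n i)\<^sup>2"
      unfolding eq increment_def by (simp add: power2_eq_square algebra_simps)
  qed
  then show ?thesis
    by (simp add: second_moment_def sum.distrib add_divide_distrib flip: sum_distrib_left)
qed

lemma increment_vanishes: "(\<lambda>n. (\<Sum>i=1..2^n. (increment n i)\<^sup>2) / 2 ^ n) \<longlonglongrightarrow> 0"
proof -
  have "incseq second_moment"
  proof (rule incseq_SucI)
    fix n
    have "0 \<le> (\<Sum>i=1..2^n. (increment n i)\<^sup>2) / 2 ^ n" by (intro divide_nonneg_nonneg sum_nonneg) auto
    then show "second_moment n \<le> second_moment (Suc n)" using second_moment_Suc[of n] by linarith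
  qed
  moreover have "second_moment n \<le> 1" for n
  proof -
    have "(\<Sum>i=1..2^n. (I n i)\<^sup>2) \<le> (\<Sum>i=1..(2::nat)^n. 1)"
      using I_range by (intro sum_mono) (auto simp: power_le_one_iff)
    then show ?thesis by (simp add: second_moment_def)
  qed
  ultimately obtain L where "second_moment \<longlonglongrightarrow> L"
    using incseq_convergent[of second_moment 1] by blast
  then have "(\<lambda>n. second_moment (Suc n) - second_moment n) \<longlonglongrightarrow> L - L"
    by (intro tendsto_diff LIMSEQ_Suc)
  then show ?thesis by (simp only: second_moment_Suc) simp
qed

lemma plus_path_range: "i \<in> {1..2^n} \<Longrightarrow> i * 2 ^ k \<in> {1..2 ^ (n + k)}" for i :: nat
  by (auto simp: power_add)

text \<open>\<open>i * 2 ^ k\<close> is the descendant of i after k plus steps. Such indices are a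
  fraction 2^-k of level n + k, so averaging over level n costs a factor 2^k, harmless for fixed
  k.\<close>

lemma plus_path_vanishes: "(\<lambda>n. (\<Sum>i=1..2^n. (I (n + k) (i * 2 ^ k) - I n i)\<^sup>2) / 2 ^ n) \<longlonglongrightarrow> 0"
proof (induction k)
  case (Suc k)
  let ?V = "\<lambda>n. (\<Sum>i=1..2^n. (increment n i)\<^sup>2) / 2 ^ n"
  let ?J = "\<lambda>k n. (\<Sum>i=1..2^n. (I (n + k) (i * 2 ^ k) - I n i)\<^sup>2) / 2 ^ n"
  have "(\<lambda>n. 2 * ?J k n + 2 * 2 ^ k * ?V (n + k)) \<longlonglongrightarrow> 2 * 0 + 2 * 2 ^ k * 0"
    by (intro tendsto_intros Suc LIMSEQ_ignore_initial_segment[OF increment_vanishes])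
  then have lim: "(\<lambda>n. 2 * ?J k n + 2 * 2 ^ k * ?V (n + k)) \<longlonglongrightarrow> 0" by simp
  have nonneg: "0 \<le> ?J (Suc k) n" for n by (intro divide_nonneg_nonneg sum_nonneg) auto
  have le: "?J (Suc k) n \<le> 2 * ?J k n + 2 * 2 ^ k * ?V (n + k)" for n
  proof -
    have "(\<Sum>i=1..2^n. (I (n + Suc k) (i * 2 ^ Suc k) - I n i)\<^sup>2)
       \<le> (\<Sum>i=1..2^n. 2 * (I (n + k) (i * 2 ^ k) - I n i)\<^sup>2 + 2 * (increment (n + k) (i * 2 ^ k))\<^sup>2)"
    proof (intro sum_mono)
      fix i
      have aux: "(a + b)\<^sup>2 \<le> 2 * a\<^sup>2 + 2 * b\<^sup>2" for a b :: real
        using sum_squares_bound[of a b] by (simp add: power2_sum)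
      have eq: "I (n + Suc k) (i * 2 ^ Suc k) - I n i = (I (n + k) (i * 2 ^ k) - I n i) + increment (n + k) (i * 2 ^ k)"
        by (simp add: increment_def ac_simps)
      show "(I (n + Suc k) (i * 2 ^ Suc k) - I n i)\<^sup>2
          \<le> 2 * (I (n + k) (i * 2 ^ k) - I n i)\<^sup>2 + 2 * (increment (n + k) (i * 2 ^ k))\<^sup>2"
        unfolding eq by (rule aux)
    qed
    moreover have "(\<Sum>i=1..2^n. (increment (n + k) (i * 2 ^ k))\<^sup>2) \<le> (\<Sum>j=1..2^(n + k). (increment (n + k) j)\<^sup>2)"
    proof -
      have "inj_on (\<lambda>i::nat. i * 2 ^ k) {1..2^n}" by (auto intro!: inj_onI)
      then have "(\<Sum>i=1..2^n. (increment (n + k) (i * 2 ^ k))\<^sup>2) = (\<Sum>j\<in>(\<lambda>i. i * 2 ^ k) ` {1..2^n}. (increment (n + k) j)\<^sup>2)"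
        by (simp add: sum.reindex)
      also have "\<dots> \<le> (\<Sum>j=1..2^(n + k). (increment (n + k) j)\<^sup>2)"
        using plus_path_range[of _ n k] by (intro sum_mono2) auto
      finally show ?thesis .
    qed
    ultimately have "(\<Sum>i=1..2^n. (I (n + Suc k) (i * 2 ^ Suc k) - I n i)\<^sup>2)
       \<le> 2 * (\<Sum>i=1..2^n. (I (n + k) (i * 2 ^ k) - I n i)\<^sup>2) + 2 * (\<Sum>j=1..2^(n + k). (increment (n + k) j)\<^sup>2)"
      unfolding sum.distrib sum_distrib_left[symmetric] by linarith
    from divide_right_mono[OF this, of "2 ^ n"] show ?thesis
      by (simp add: add_divide_distrib power_add)
  qed
  show ?case
    by (rule tendsto_sandwich[OF always_eventually[OF allI[OF nonneg]] always_eventually[OF allI[OF le]] tendsto_const lim])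
qed simp

lemma Q_plus_path: "i \<in> {1..2^n} \<Longrightarrow> Q n i q \<Longrightarrow> Q (n + k) (i * 2 ^ k) (q ^ (2 ^ k))"
proof (induction k)
  case (Suc k)
  then show ?case
    using Q_square[OF plus_path_range[of i n k], of "q ^ (2 ^ k)"]
    by (simp add: ac_simps power_mult[symmetric])
qed simp

text \<open>A constant number of plus transforms, depending only on \<open>\<delta>\<close>, squares the overlap of a
  non-degenerate channel down to almost \<open>0\<close>, which moves \<open>I\<close> by at least \<open>\<delta> / 2\<close>.\<close>

lemma plus_path_jump:
  assumes "0 < \<delta>" "\<delta> < 1"
  obtains k where "\<And>n i. i \<in> {1..2^n} \<Longrightarrow> \<delta> \<le> I n i \<Longrightarrow> 1 - \<delta> / 2 \<le> I (n + k) (i * 2 ^ k)"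
proof -
  \<comment> \<open>\<eta> is calibrated so that, with the \<epsilon> chosen below, the upper bound
    on I reads \<open>\<delta> / 2 + (1 - q) * (\<delta> / 2) / \<eta>\<close>; then \<delta> \<le>
    I forces q \<le> 1 - \<eta>.\<close>
  define \<eta> where "\<eta> = \<delta>\<^sup>2 * (ln 2)\<^sup>2 / (8::real)"
  have ln2: "0 < ln (2::real)" "ln (2::real) \<le> 1" using ln_le_minus_one[of "2::real"] by auto
  have \<eta>0: "0 < \<eta>" using assms ln2 by (simp add: \<eta>_def)
  have "\<delta>\<^sup>2 * (ln 2)\<^sup>2 \<le> 1 * (1::real)" using assms ln2 by (intro mult_mono power_le_one) auto
  then have \<eta>1: "\<eta> < 1" by (simp add: \<eta>_def)
  have "(\<lambda>m. (1 - \<eta>) ^ m) \<longlonglongrightarrow> 0" using \<eta>0 \<eta>1 by (intro LIMSEQ_power_zero) auto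
  moreover have "0 < \<delta> / 2 * ln 2" using assms ln2 by simp
  ultimately have "\<forall>\<^sub>F m in sequentially. (1 - \<eta>) ^ m < \<delta> / 2 * ln 2" by (rule order_tendstoD)
  then obtain k where k: "(1 - \<eta>) ^ m < \<delta> / 2 * ln 2" if "k \<le> m" for m
    by (auto simp: eventually_sequentially)
  have "1 - \<delta> / 2 \<le> I (n + k) (i * 2 ^ k)" if i: "i \<in> {1..2^n}" and I: "\<delta> \<le> I n i" for n i
  proof -
    obtain q where q: "Q n i q" using Q_ex[OF i] by blast
    define \<epsilon> where "\<epsilon> = \<delta> * ln 2 / 4"
    have e: "0 < \<epsilon>" using assms ln2 by (simp add: \<epsilon>_def)
    have "\<delta> \<le> 2 / ln 2 * (\<epsilon> + (1 - q) / (2 * \<epsilon>))" using I_le[OF i q e] I by linarith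
    also have "\<dots> = \<delta> / 2 + (1 - q) * (\<delta> / 2) / \<eta>"
      using ln2 assms by (simp add: \<epsilon>_def \<eta>_def field_simps power2_eq_square)
    finally have "\<delta> * (\<eta> + q) \<le> \<delta> * 1" using \<eta>0 assms by (simp add: field_simps)
    then have "\<eta> \<le> 1 - q" using mult_left_le_imp_le[of \<delta> "\<eta> + q" 1] assms by simp
    then have "q ^ (2 ^ k) \<le> (1 - \<eta>) ^ (2 ^ k)" using Q_nonneg[OF i q] by (intro power_mono) auto
    also have "\<dots> < \<delta> / 2 * ln 2" by (intro k less_imp_le less_exp)
    finally have "q ^ (2 ^ k) / ln 2 \<le> \<delta> / 2" using ln2 by (simp add: field_simps)
    then show ?thesis using I_ge[OF plus_path_range[OF i] Q_plus_path[OF i q], of k] by linarith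
  qed
  then show thesis using that by blast
qed

text \<open>Chebyshev: a channel in the middle band climbs from at most 1 - \<delta> to at least 1 -
  \<delta> / 2 along the plus path, so it contributes at least \<open>(\<delta> / 2)^2\<close> to a
  mean square that vanishes.\<close>

lemma unpolarized_vanishes:
  assumes "0 < \<delta>" "\<delta> < 1"
  shows "(\<lambda>n. (\<Sum>i=1..2^n. of_bool (\<delta> \<le> I n i \<and> I n i \<le> 1 - \<delta>)) / 2 ^ n) \<longlonglongrightarrow> (0::real)"
proof -
  obtain k where k: "\<And>n i. i \<in> {1..2^n} \<Longrightarrow> \<delta> \<le> I n i \<Longrightarrow> 1 - \<delta> / 2 \<le> I (n + k) (i * 2 ^ k)"
    using plus_path_jump[OF assms] by blast
  let ?M = "\<lambda>n. (\<Sum>i=1..2^n. of_bool (\<delta> \<le> I n i \<and> I n i \<le> 1 - \<delta>)) / 2 ^ n :: real"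
  let ?J = "\<lambda>n. (\<Sum>i=1..2^n. (I (n + k) (i * 2 ^ k) - I n i)\<^sup>2) / 2 ^ n"
  have le: "?M n \<le> ?J n * (4 / \<delta>\<^sup>2)" for n
  proof -
    have "(\<Sum>i=1..2^n. of_bool (\<delta> \<le> I n i \<and> I n i \<le> 1 - \<delta>)) \<le> (\<Sum>i=1..2^n. (I (n + k) (i * 2 ^ k) - I n i)\<^sup>2 * (4 / \<delta>\<^sup>2))"
    proof (intro sum_mono)
      fix i :: nat assume i: "i \<in> {1..2^n}"
      show "of_bool (\<delta> \<le> I n i \<and> I n i \<le> 1 - \<delta>) \<le> (I (n + k) (i * 2 ^ k) - I n i)\<^sup>2 * (4 / \<delta>\<^sup>2)"
      proof (cases "\<delta> \<le> I n i \<and> I n i \<le> 1 - \<delta>")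
        case True
        then have "\<delta> / 2 \<le> I (n + k) (i * 2 ^ k) - I n i" using k[OF i] by simp
        then have "(\<delta> / 2)\<^sup>2 \<le> (I (n + k) (i * 2 ^ k) - I n i)\<^sup>2" using assms by (intro power_mono) auto
        then show ?thesis using True assms by (simp add: field_simps)
      qed auto
    qed
    from divide_right_mono[OF this, of "2 ^ n"] show ?thesis
      unfolding sum_distrib_right[symmetric] by (simp only: times_divide_eq_left zero_le_power zero_le_numeral)
  qed
  have "(\<lambda>n. ?J n * (4 / \<delta>\<^sup>2)) \<longlonglongrightarrow> 0 * (4 / \<delta>\<^sup>2)"
    by (intro tendsto_intros plus_path_vanishes)
  then have lim: "(\<lambda>n. ?J n * (4 / \<delta>\<^sup>2)) \<longlonglongrightarrow> 0" by simp
  have nonneg: "0 \<le> ?M n" for n by (intro divide_nonneg_nonneg sum_nonneg) auto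
  show ?thesis
    by (rule tendsto_sandwich[OF always_eventually[OF allI[OF nonneg]] always_eventually[OF allI[OF le]] tendsto_const lim])
qed

text \<open>f stands for the indicator of a near-extreme set and g for x or 1 - x: outside the band
  they agree up to \<delta>', inside they differ by at most 1. Shrinking the band below \<delta>
  makes the limit independent of \<delta>.\<close>

lemma average_tendsto:
  assumes \<delta>: "0 < \<delta>" "\<delta> < 1"
    and close: "\<And>x \<delta>'. 0 \<le> x \<Longrightarrow> x \<le> 1 \<Longrightarrow> 0 < \<delta>' \<Longrightarrow> \<delta>' \<le> \<delta> \<Longrightarrow> \<delta>' \<le> 1 - \<delta> \<Longrightarrow>
      \<bar>f x - g x\<bar> \<le> \<delta>' + of_bool (\<delta>' \<le> x \<and> x \<le> 1 - \<delta>')"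
  shows "(\<lambda>n. (\<Sum>i=1..2^n. f (I n i)) / 2 ^ n - (\<Sum>i=1..2^n. g (I n i)) / 2 ^ n) \<longlonglongrightarrow> (0::real)"
proof (rule LIMSEQ_I)
  fix e :: real assume e: "0 < e"
  \<comment> \<open>Staying below both \<delta> and 1 - \<delta> keeps the jump of f inside the
    band; e / 2 is half of the error budget.\<close>
  define \<delta>' where "\<delta>' = min (min \<delta> (1 - \<delta>)) (e / 2)"
  have "\<delta>' \<le> e / 2" unfolding \<delta>'_def by (rule min.cobounded2)
  then have \<delta>': "0 < \<delta>'" "\<delta>' \<le> \<delta>" "\<delta>' \<le> 1 - \<delta>" "\<delta>' \<le> e / 2" "\<delta>' < 1"
    using \<delta> e by (auto simp: \<delta>'_def)
  let ?M = "\<lambda>n. (\<Sum>i=1..2^n. of_bool (\<delta>' \<le> I n i \<and> I n i \<le> 1 - \<delta>')) / 2 ^ n :: real"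
  from order_tendstoD(2)[OF unpolarized_vanishes[OF \<delta>'(1,5)], of "e / 2"] e
  obtain N where N: "?M n < e / 2" if "N \<le> n" for n by (auto simp: eventually_sequentially)
  have "norm ((\<Sum>i=1..2^n. f (I n i)) / 2 ^ n - (\<Sum>i=1..2^n. g (I n i)) / 2 ^ n - 0) < e" if n: "N \<le> n" for n
  proof -
    have "\<bar>\<Sum>i=1..2^n. f (I n i) - g (I n i)\<bar> \<le> (\<Sum>i=1..2^n. \<bar>f (I n i) - g (I n i)\<bar>)" by (rule sum_abs)
    also have "\<dots> \<le> (\<Sum>i=1..2^n. \<delta>' + of_bool (\<delta>' \<le> I n i \<and> I n i \<le> 1 - \<delta>'))"
      using I_range \<delta>' by (intro sum_mono close) auto
    finally have "\<bar>\<Sum>i=1..2^n. f (I n i) - g (I n i)\<bar> / 2 ^ n \<le> \<delta>' + ?M n"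
      by (simp add: sum.distrib field_simps)
    then have "\<bar>\<Sum>i=1..2^n. f (I n i) - g (I n i)\<bar> / 2 ^ n < e" using N[OF n] \<delta>'(4) by linarith
    then show ?thesis
      by (simp add: sum_subtractf abs_divide flip: diff_divide_distrib)
  qed
  then show "\<exists>N. \<forall>n\<ge>N. norm ((\<Sum>i=1..2^n. f (I n i)) / 2 ^ n - (\<Sum>i=1..2^n. g (I n i)) / 2 ^ n - 0) < e" by blast
qed

lemma fraction_near_1_tendsto:
  assumes "0 < \<delta>" "\<delta> < 1"
  shows "(\<lambda>n. real (card {i \<in> {1..2^n}. I n i \<in> {1 - \<delta><..1}}) / 2 ^ n) \<longlonglongrightarrow> I 0 1"
proof -
  have "(\<lambda>n. (\<Sum>i=1..2^n. of_bool (I n i \<in> {1 - \<delta><..1})) / 2 ^ n - (\<Sum>i=1..2^n. I n i) / 2 ^ n) \<longlonglongrightarrow> (0::real)"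
    by (rule average_tendsto[where f = "\<lambda>x. of_bool (x \<in> {1 - \<delta><..1})" and g = "\<lambda>x. x", OF assms])
      (auto simp: of_bool_def)
  moreover have "(\<Sum>i=1..2^n. I n i) / 2 ^ n = I 0 1" for n unfolding mean by simp
  ultimately show ?thesis
    unfolding card_filter_eq_sum[OF finite_atLeastAtMost] by (simp only: LIM_zero_iff)
qed

lemma fraction_near_0_tendsto:
  assumes "0 < \<delta>" "\<delta> < 1"
  shows "(\<lambda>n. real (card {i \<in> {1..2^n}. I n i \<in> {0..<\<delta>}}) / 2 ^ n) \<longlonglongrightarrow> 1 - I 0 1"
proof -
  have "(\<lambda>n. (\<Sum>i=1..2^n. of_bool (I n i \<in> {0..<\<delta>})) / 2 ^ n - (\<Sum>i=1..2^n. 1 - I n i) / 2 ^ n) \<longlonglongrightarrow> (0::real)"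
    by (rule average_tendsto[where f = "\<lambda>x. of_bool (x \<in> {0..<\<delta>})" and g = "\<lambda>x. 1 - x", OF assms])
      (auto simp: of_bool_def)
  moreover have "(\<Sum>i=1..2^n. 1 - I n i) / 2 ^ n = 1 - I 0 1" for n
    unfolding sum_subtractf mean by (simp add: diff_divide_distrib)
  ultimately show ?thesis
    unfolding card_filter_eq_sum[OF finite_atLeastAtMost] by (simp only: LIM_zero_iff)
qed

end


section \<open>Density matrices, prefixes and classical-quantum states\<close>

definition density :: "nat \<Rightarrow> complex mat \<Rightarrow> bool" where
  "density d A \<longleftrightarrow> psd d A \<and> mtrace A = 1"

lemma density_op_density:
  assumes "density_op d A"
  shows "density d A"
proof -
  have A: "A \<in> carrier_mat d d" "mat_adjoint A = A" using assms by (auto simp: density_op_def)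
  have "A $$ (b,a) = cnj (A $$ (a,b))" if "a < d" "b < d" for a b
  proof -
    have "mat_adjoint A $$ (b,a) = cnj (A $$ (a,b))"
      using A(1) that by (simp add: mat_adjoint_def mat_of_rows_def)
    then show ?thesis by (simp add: A(2))
  qed
  moreover have "0 \<le> Re (ip d v (mv d A v))" for v
  proof -
    have "scalar_prod (conjugate (vec d v)) (A *\<^sub>v vec d v) = ip d v (mv d A v)"
      using A(1) by (simp add: scalar_prod_def ip_def mv_def atLeast0LessThan)
    moreover have "0 \<le> Re (scalar_prod (conjugate (vec d v)) (A *\<^sub>v vec d v))"
      using assms by (simp add: density_op_def)
    ultimately show ?thesis by simp
  qed
  moreover have "mtrace A = 1" using assms by (simp add: density_op_def)
  ultimately show ?thesis unfolding density_def psd_def herm_def using A(1) by blast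
qed

lemma density_kron: "density d A \<Longrightarrow> density e B \<Longrightarrow> density (d * e) (kron A B)"
  unfolding density_def using mtrace_kron psd_carrier psd_kron by (metis mult_1)

lemma density_carrier: "density d A \<Longrightarrow> A \<in> carrier_mat d d"
  by (simp add: density_def psd_carrier)

lemma density_average:
  assumes "finite S" "S \<noteq> {}" "\<And>s. s \<in> S \<Longrightarrow> density d (B s)" "A \<in> carrier_mat d d"
    and ent: "\<And>a b. a < d \<Longrightarrow> b < d \<Longrightarrow> A $$ (a,b) = (\<Sum>s\<in>S. of_real (1 / real (card S)) * B s $$ (a,b))"
  shows "density d A"
  unfolding density_def
proof
  show "psd d A"
    by (rule psd_linear_combination[of A d S B "\<lambda>_. 1 / real (card S)"]) (use assms in \<open>auto simp: density_def\<close>)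
  have "mtrace A = (\<Sum>a<d. \<Sum>s\<in>S. of_real (1 / real (card S)) * B s $$ (a,a))"
    using assms(4) ent by (simp add: mtrace_def)
  also have "\<dots> = (\<Sum>s\<in>S. of_real (1 / real (card S)) * mtrace (B s))"
    using assms(3)[THEN density_carrier, THEN carrier_matD(1)]
    by (subst sum.swap) (simp add: mtrace_def sum_distrib_left)
  also have "\<dots> = 1" using assms(1-3) by (simp add: density_def)
  finally show "mtrace A = 1" .
qed

section \<open>Bit words and the index permutation of channel combining\<close>

abbreviation bitvecs :: "nat \<Rightarrow> bool list set" where
  "bitvecs m \<equiv> {u. length u = m}"

lemma finite_bitvecs: "finite (bitvecs m)"
  using finite_lists_length_eq[of "UNIV :: bool set" m] by simp

lemma card_bitvecs: "card (bitvecs m) = 2 ^ m"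
  using card_lists_length_eq[of "UNIV :: bool set" m] by simp

lemma sum_bitvecs_Cons:
  "(\<Sum>u\<in>bitvecs (Suc m). f u) = (\<Sum>u\<in>bitvecs m. f (False # u)) + (\<Sum>u\<in>bitvecs m. f (True # u))"
proof -
  have eq: "bitvecs (Suc m) = (#) False ` bitvecs m \<union> (#) True ` bitvecs m"
    by (auto simp: length_Suc_conv image_iff)
  show ?thesis unfolding eq
    by (subst sum.union_disjoint) (auto simp: finite_bitvecs sum.reindex)
qed

lemma sum_bitvecs_snoc:
  "(\<Sum>u\<in>bitvecs (Suc m). f u) = (\<Sum>u\<in>bitvecs m. f (u @ [False])) + (\<Sum>u\<in>bitvecs m. f (u @ [True]))"
proof -
  have eq: "bitvecs (Suc m) = (\<lambda>u. u @ [False]) ` bitvecs m \<union> (\<lambda>u. u @ [True]) ` bitvecs m"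
    by (auto simp: length_Suc_conv_rev image_iff)
  show ?thesis unfolding eq
    by (subst sum.union_disjoint) (auto simp: finite_bitvecs sum.reindex inj_on_def)
qed

text \<open>Inverse of \<open>u \<mapsto> (odds u \<oplus> evens u, evens u)\<close> on lists of even length.\<close>

fun butterfly :: "bool list \<Rightarrow> bool list \<Rightarrow> bool list" where
  "butterfly (x # s) (y # e) = (x \<noteq> y) # y # butterfly s e"
| "butterfly _ _ = []"

definition parities :: "bool list \<Rightarrow> bool list" where
  "parities u = map2 (\<noteq>) (odds u) (evens u)"

lemma odds_Nil [simp]: "odds [] = []" and evens_Nil [simp]: "evens [] = []"
  by (simp_all add: odds_def evens_def)

lemma odds_Cons_Cons [simp]: "odds (x # y # u) = x # odds u"
  and evens_Cons_Cons [simp]: "evens (x # y # u) = y # evens u"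
  by (simp_all add: odds_def evens_def upt_conv_Cons map_Suc_upt[symmetric] del: upt_Suc)

lemma parities_Nil [simp]: "parities [] = []"
  and parities_Cons_Cons [simp]: "parities (x # y # u) = (x \<noteq> y) # parities u"
  by (simp_all add: parities_def)

lemma butterfly_inverse:
  "length s = length e \<Longrightarrow>
     length (butterfly s e) = 2 * length s \<and> parities (butterfly s e) = s \<and> evens (butterfly s e) = e"
  by (induction s e rule: butterfly.induct) auto

lemma inverse_butterfly:
  "length u = 2 * m \<Longrightarrow> length (parities u) = m \<and> length (evens u) = m \<and> butterfly (parities u) (evens u) = u"
proof (induction m arbitrary: u)
  case (Suc m)
  then obtain x y v where "u = x # y # v" "length v = 2 * m"
    by (auto simp: length_Suc_conv)
  then show ?case using Suc.IH[of v] by auto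
qed simp

text \<open>Interleaving respects prefixes, so averaging over the last 2 m bits of a combined word
  is an independent average over the last m bits of each half.\<close>

lemma butterfly_append:
  "length s = length e \<Longrightarrow> butterfly (s @ s') (e @ e') = butterfly s e @ butterfly s' e'"
  by (induction s e rule: butterfly.induct) auto

lemma comb_butterfly:
  "length s = length e \<Longrightarrow> comb W (Suc n) (butterfly s e) = kron (comb W n s) (comb W n e)"
  using butterfly_inverse[of s e] unfolding comb.simps parities_def[symmetric] by simp

lemma sum_bitvecs_butterfly:
  "(\<Sum>u\<in>bitvecs (2 * m). f u) = (\<Sum>s\<in>bitvecs m. \<Sum>e\<in>bitvecs m. f (butterfly s e))"
  unfolding sum.cartesian_product
  by (rule sum.reindex_bij_witness[of _ "\<lambda>(s,e). butterfly s e" "\<lambda>u. (parities u, evens u)"])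
    (auto dest: inverse_butterfly simp: butterfly_inverse)

lemma bits_to_nat_less: "bits_to_nat u < 2 ^ length u"
  by (induction u) auto

lemma bits_to_nat_inj: "length u = length v \<Longrightarrow> bits_to_nat u = bits_to_nat v \<longleftrightarrow> u = v"
proof (induction u v rule: list_induct2)
  case (Cons x u y v)
  then show ?case by (cases x; cases y; auto; presburger)
qed simp

lemma msum_entry: "i < D \<Longrightarrow> j < D \<Longrightarrow> msum D S f $$ (i,j) = (\<Sum>x\<in>S. f x $$ (i,j))"
  by (simp add: msum_def)

lemma msum_carrier: "msum D S f \<in> carrier_mat D D"
  by (simp add: msum_def)

lemma msum_dim [simp]: "dim_row (msum D S f) = D" "dim_col (msum D S f) = D"
  by (simp_all add: msum_def)

section \<open>Classical-quantum states with a uniform register\<close>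

lemma cq_state_entry:
  assumes "\<And>u. u \<in> bitvecs m \<Longrightarrow> B u \<in> carrier_mat D D" "a < 2 ^ m * D" "b < 2 ^ m * D"
  shows "msum (2 ^ m * D) (bitvecs m) (\<lambda>u. (1 / 2 ^ m :: complex) \<cdot>\<^sub>m kron (basis_proj (2 ^ m) (bits_to_nat u)) (B u)) $$ (a,b)
     = (\<Sum>u\<in>bitvecs m. 1 / 2 ^ m * (of_bool (a div D = bits_to_nat u) * of_bool (b div D = bits_to_nat u)) * B u $$ (a mod D, b mod D))"
  unfolding msum_entry[OF assms(2,3)]
proof (intro sum.cong refl)
  fix u assume u: "u \<in> bitvecs m"
  have bp: "basis_proj (2 ^ m) (bits_to_nat u) \<in> carrier_mat (2 ^ m) (2 ^ m)" by (simp add: basis_proj_def)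
  show "((1 / 2 ^ m :: complex) \<cdot>\<^sub>m kron (basis_proj (2 ^ m) (bits_to_nat u)) (B u)) $$ (a,b)
      = 1 / 2 ^ m * (of_bool (a div D = bits_to_nat u) * of_bool (b div D = bits_to_nat u)) * B u $$ (a mod D, b mod D)"
    using kron_carrier[OF bp assms(1)[OF u]] kron_entry[OF bp assms(1)[OF u] assms(2,3)] assms(2,3)
      div_mod_less[OF assms(2)] div_mod_less[OF assms(3)]
    by (simp add: basis_proj_def)
qed

text \<open>The blocks are orthogonal, so register basis vectors times block eigenvectors form an
  eigenbasis, with eigenvalues scaled by 2^-m. The summand m is the entropy of the uniform
  register.\<close>

lemma vn_entropy_cq_state:
  assumes B: "\<And>u. u \<in> bitvecs m \<Longrightarrow> density D (B u)"
  shows "vn_entropy (msum (2 ^ m * D) (bitvecs m) (\<lambda>u. (1 / 2 ^ m :: complex) \<cdot>\<^sub>m kron (basis_proj (2 ^ m) (bits_to_nat u)) (B u)))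
     = (\<Sum>u\<in>bitvecs m. vn_entropy (B u)) / 2 ^ m + real m"
proof -
  let ?M = "msum (2 ^ m * D) (bitvecs m) (\<lambda>u. (1 / 2 ^ m :: complex) \<cdot>\<^sub>m kron (basis_proj (2 ^ m) (bits_to_nat u)) (B u))"
  have "\<exists>l x. spectral D (B u) {..<D} l x" if "u \<in> bitvecs m" for u
    using herm_spectral psd_herm B[OF that] unfolding density_def by blast
  then obtain l x where s: "\<And>u. u \<in> bitvecs m \<Longrightarrow> spectral D (B u) {..<D} (l u) (x u)" by metis
  have l: "0 \<le> l u j" if "u \<in> bitvecs m" "j < D" for u j
    using spectral_psd_iff[OF s[OF that(1)]] B[OF that(1)] that(2) by (simp add: density_def)
  have tr: "(\<Sum>j<D. l u j) = 1" if "u \<in> bitvecs m" for u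
    using spectral_trace[OF s[OF that]] B[OF that] unfolding density_def by (metis of_real_eq_1_iff)
  have "spectral (2 ^ m * D) ?M (bitvecs m \<times> {..<D}) (\<lambda>(u,j). l u j * (1 / 2 ^ m))
      (\<lambda>(u,j) a. of_bool (a div D = bits_to_nat u) * x u j (a mod D))"
    unfolding spectral_def orthonormal_basis_def
  proof (intro conjI ballI allI impI)
    show "?M \<in> carrier_mat (2 ^ m * D) (2 ^ m * D)" by (rule msum_carrier)
    show "finite (bitvecs m \<times> {..<D})" "card (bitvecs m \<times> {..<D}) = 2 ^ m * D"
      by (simp_all add: finite_bitvecs card_bitvecs card_cartesian_product)
    fix p q assume "p \<in> bitvecs m \<times> {..<D}" "q \<in> bitvecs m \<times> {..<D}"
    then obtain u j v k where pq: "p = (u,j)" "q = (v,k)" and u: "length u = m" "length v = m" "j < D" "k < D"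
      by auto
    have "ip (2 ^ m * D) (\<lambda>a. of_bool (a div D = bits_to_nat u) * x u j (a mod D)) (\<lambda>a. of_bool (a div D = bits_to_nat v) * x v k (a mod D))
        = ip (2 ^ m) (\<lambda>a. of_bool (a = bits_to_nat u)) (\<lambda>a. of_bool (a = bits_to_nat v)) * ip D (x u j) (x v k)"
      by (rule ip_kron)
    also have "ip (2 ^ m) (\<lambda>a. of_bool (a = bits_to_nat u)) (\<lambda>a. of_bool (a = bits_to_nat v)) = of_bool (u = v)"
      using bits_to_nat_less[of u] bits_to_nat_inj[of u v] u
      by (auto simp: ip_def of_bool_def if_distrib[of "\<lambda>t. t * _"] if_distrib[of cnj] cong: if_cong)
    also have "of_bool (u = v) * ip D (x u j) (x v k) = of_bool (p = q)"
      using s[of u] u by (auto simp: pq spectral_def orthonormal_basis_def)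
    finally show "ip (2 ^ m * D) ((\<lambda>(u,j) a. of_bool (a div D = bits_to_nat u) * x u j (a mod D)) p)
        ((\<lambda>(u,j) a. of_bool (a div D = bits_to_nat u) * x u j (a mod D)) q) = of_bool (p = q)"
      by (simp add: pq)
  next
    fix a b assume ab: "a < 2 ^ m * D" "b < 2 ^ m * D"
    have "?M $$ (a,b) = (\<Sum>u\<in>bitvecs m. 1 / 2 ^ m * (of_bool (a div D = bits_to_nat u) * of_bool (b div D = bits_to_nat u)) * B u $$ (a mod D, b mod D))"
      using B by (intro cq_state_entry ab density_carrier) auto
    also have "\<dots> = (\<Sum>u\<in>bitvecs m. \<Sum>j<D. of_real (l u j * (1 / 2 ^ m)) * (of_bool (a div D = bits_to_nat u) * x u j (a mod D))
        * cnj (of_bool (b div D = bits_to_nat u) * x u j (b mod D)))"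
    proof (intro sum.cong refl)
      fix u assume "u \<in> bitvecs m"
      then have "B u $$ (a mod D, b mod D) = (\<Sum>j<D. of_real (l u j) * x u j (a mod D) * cnj (x u j (b mod D)))"
        using s div_mod_less[OF ab(1)] div_mod_less[OF ab(2)] by (simp add: spectral_def)
      then show "1 / 2 ^ m * (of_bool (a div D = bits_to_nat u) * of_bool (b div D = bits_to_nat u)) * B u $$ (a mod D, b mod D)
        = (\<Sum>j<D. of_real (l u j * (1 / 2 ^ m)) * (of_bool (a div D = bits_to_nat u) * x u j (a mod D))
        * cnj (of_bool (b div D = bits_to_nat u) * x u j (b mod D)))"
        by (simp add: sum_distrib_left ac_simps)
    qed
    finally show "?M $$ (a,b) = (\<Sum>p\<in>bitvecs m \<times> {..<D}. of_real ((\<lambda>(u,j). l u j * (1 / 2 ^ m)) p) *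
       (\<lambda>(u,j) a. of_bool (a div D = bits_to_nat u) * x u j (a mod D)) p a *
       cnj ((\<lambda>(u,j) a. of_bool (a div D = bits_to_nat u) * x u j (a mod D)) p b))"
      by (simp add: sum.cartesian_product case_prod_unfold)
  qed
  then have "vn_entropy ?M = - (\<Sum>u\<in>bitvecs m. \<Sum>j<D. xlogx (l u j * (1 / 2 ^ m)))"
    by (simp add: spectral_vn_entropy sum.cartesian_product case_prod_unfold)
  also have "(\<Sum>u\<in>bitvecs m. \<Sum>j<D. xlogx (l u j * (1 / 2 ^ m)))
     = (\<Sum>u\<in>bitvecs m. - vn_entropy (B u) / 2 ^ m - real m / 2 ^ m)"
  proof (intro sum.cong refl)
    fix u assume u: "u \<in> bitvecs m"
    have "\<not> 1 / 2 ^ m \<le> (0::real)" by (simp add: not_le)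
    then have "xlogx (1 / 2 ^ m) = - real m / 2 ^ m"
      by (simp add: xlogx_def log_divide log_nat_power del: divide_le_0_1_iff)
    then have "xlogx (l u j * (1 / 2 ^ m)) = xlogx (l u j) / 2 ^ m - l u j * (real m / 2 ^ m)" if "j < D" for j
      using xlogx_mult[OF l[OF u that], of "1 / 2 ^ m"] by simp
    then have "(\<Sum>j<D. xlogx (l u j * (1 / 2 ^ m))) = (\<Sum>j<D. xlogx (l u j) / 2 ^ m - l u j * (real m / 2 ^ m))"
      by (intro sum.cong refl) simp
    also have "\<dots> = - vn_entropy (B u) / 2 ^ m - real m / 2 ^ m"
      using tr[OF u] by (simp add: sum_subtractf spectral_vn_entropy[OF s[OF u]] flip: sum_divide_distrib sum_distrib_right)
    finally show "(\<Sum>j<D. xlogx (l u j * (1 / 2 ^ m))) = - vn_entropy (B u) / 2 ^ m - real m / 2 ^ m" .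
  qed
  finally show ?thesis
    by (simp add: sum_subtractf sum_negf card_bitvecs flip: sum_divide_distrib)
qed


section \<open>The polarization process of a cq channel\<close>

locale cq_channel =
  fixes W :: "bool \<Rightarrow> complex mat" and d :: nat
  assumes density_W: "density d (W x)"
begin

abbreviation sys_dim :: "nat \<Rightarrow> nat" where
  "sys_dim n \<equiv> d ^ 2 ^ n"

lemma dim_row_W [simp]: "dim_row (W x) = d"
  using density_carrier[OF density_W] by auto

lemma sys_dim_Suc: "sys_dim (Suc n) = sys_dim n * sys_dim n"
  by (simp add: mult_2 flip: power_add)

lemma density_comb: "density (sys_dim n) (comb W n u)"
proof (induction n arbitrary: u)
  case 0
  then show ?case by (simp add: density_W)
next
  case (Suc n)
  show ?case unfolding sys_dim_Suc comb.simps by (intro density_kron Suc)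
qed

section \<open>States of prefixes, averaged over the remaining bits\<close>

abbreviation \<rho> :: "nat \<Rightarrow> bool list \<Rightarrow> complex mat" where
  "\<rho> n u \<equiv> avg_state W n u"

lemma avg_state_carrier: "\<rho> n u \<in> carrier_mat (sys_dim n) (sys_dim n)"
  by (simp add: avg_state_def msum_carrier Let_def)

lemma avg_state_entry:
  assumes "length u + m = 2 ^ n" "a < sys_dim n" "b < sys_dim n"
  shows "\<rho> n u $$ (a,b) = (\<Sum>v\<in>bitvecs m. comb W n (u @ v) $$ (a,b)) / 2 ^ m"
proof -
  have m: "2 ^ n - length u = m" using assms(1) by simp
  show ?thesis
    using assms(2,3) density_carrier[OF density_comb, THEN carrier_matD(1)] density_carrier[OF density_comb, THEN carrier_matD(2)]
    by (simp add: avg_state_def m Let_def msum_entry flip: sum_divide_distrib)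
qed

lemma density_avg_state:
  assumes "length u \<le> 2 ^ n"
  shows "density (sys_dim n) (\<rho> n u)"
proof (rule density_average[of "bitvecs (2 ^ n - length u)" _ "\<lambda>v. comb W n (u @ v)"])
  show "bitvecs (2 ^ n - length u) \<noteq> {}"
    using card_bitvecs[of "2 ^ n - length u"] by (metis card.empty power_not_zero zero_neq_numeral)
  fix a b assume "a < sys_dim n" "b < sys_dim n"
  then show "\<rho> n u $$ (a,b) = (\<Sum>v\<in>bitvecs (2 ^ n - length u).
      of_real (1 / real (card (bitvecs (2 ^ n - length u)))) * comb W n (u @ v) $$ (a,b))"
    using avg_state_entry[of u "2 ^ n - length u" n a b] assms
    by (simp add: card_bitvecs sum_divide_distrib)
qed (auto simp: finite_bitvecs density_comb avg_state_carrier)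

lemma avg_state_split:
  assumes "length u < 2 ^ n"
  shows "(1/2::complex) \<cdot>\<^sub>m (\<rho> n (u @ [False]) + \<rho> n (u @ [True])) = \<rho> n u"
proof (rule eq_matI)
  fix a b assume "a < dim_row (\<rho> n u)" "b < dim_col (\<rho> n u)"
  then have ab: "a < sys_dim n" "b < sys_dim n" using avg_state_carrier[of n u] by auto
  obtain m where m: "length u + Suc m = 2 ^ n"
    using assms by (metis add_Suc_right less_imp_Suc_add)
  have e: "\<rho> n (u @ [x]) $$ (a,b) = (\<Sum>v\<in>bitvecs m. comb W n (u @ x # v) $$ (a,b)) / 2 ^ m" for x
    using avg_state_entry[of "u @ [x]" m n a b] m ab by simp
  have c: "\<rho> n (u @ [False]) \<in> carrier_mat (sys_dim n) (sys_dim n)" "\<rho> n (u @ [True]) \<in> carrier_mat (sys_dim n) (sys_dim n)"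
    by (rule avg_state_carrier)+
  have "\<rho> n u $$ (a,b) = (\<rho> n (u @ [False]) $$ (a,b) + \<rho> n (u @ [True]) $$ (a,b)) / 2"
    unfolding e avg_state_entry[OF m ab] sum_bitvecs_Cons by (simp add: add_divide_distrib mult.commute)
  then show "((1/2::complex) \<cdot>\<^sub>m (\<rho> n (u @ [False]) + \<rho> n (u @ [True]))) $$ (a,b) = \<rho> n u $$ (a,b)"
    using c ab by auto
qed (use avg_state_carrier[of n u] avg_state_carrier[of n "u @ [True]"] in auto)

text \<open>A prefix of even length cuts no pair of bits, so entrywise the sum over suffixes is a
  product of two independent sums.\<close>

lemma avg_state_butterfly:
  assumes "length s = length e" "length s \<le> 2 ^ n"
  shows "\<rho> (Suc n) (butterfly s e) = kron (\<rho> n s) (\<rho> n e)"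
proof (rule eq_matI)
  have K: "kron (\<rho> n s) (\<rho> n e) \<in> carrier_mat (sys_dim (Suc n)) (sys_dim (Suc n))"
    unfolding sys_dim_Suc by (intro kron_carrier avg_state_carrier)
  then show "dim_row (\<rho> (Suc n) (butterfly s e)) = dim_row (kron (\<rho> n s) (\<rho> n e))"
    "dim_col (\<rho> (Suc n) (butterfly s e)) = dim_col (kron (\<rho> n s) (\<rho> n e))"
    using avg_state_carrier[of "Suc n" "butterfly s e"] by auto
  fix a b assume "a < dim_row (kron (\<rho> n s) (\<rho> n e))" "b < dim_col (kron (\<rho> n s) (\<rho> n e))"
  then have ab: "a < sys_dim n * sys_dim n" "b < sys_dim n * sys_dim n" using K unfolding sys_dim_Suc by auto
  obtain m where m: "length s + m = 2 ^ n" using assms(2) le_Suc_ex by metis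
  have "length (butterfly s e) + 2 * m = 2 ^ Suc n" using m butterfly_inverse[OF assms(1)] by simp
  from avg_state_entry[OF this] ab
  have "\<rho> (Suc n) (butterfly s e) $$ (a,b) = (\<Sum>v\<in>bitvecs (2 * m). comb W (Suc n) (butterfly s e @ v) $$ (a,b)) / 2 ^ (2 * m)"
    unfolding sys_dim_Suc by blast
  also have "(\<Sum>v\<in>bitvecs (2 * m). comb W (Suc n) (butterfly s e @ v) $$ (a,b))
      = (\<Sum>s'\<in>bitvecs m. \<Sum>e'\<in>bitvecs m. comb W n (s @ s') $$ (a div sys_dim n, b div sys_dim n) * comb W n (e @ e') $$ (a mod sys_dim n, b mod sys_dim n))"
    unfolding sum_bitvecs_butterfly
  proof (intro sum.cong refl)
    fix s' e' assume "s' \<in> bitvecs m" "e' \<in> bitvecs m"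
    then have "comb W (Suc n) (butterfly s e @ butterfly s' e') = kron (comb W n (s @ s')) (comb W n (e @ e'))"
      unfolding butterfly_append[OF assms(1), symmetric] by (intro comb_butterfly) (simp add: assms(1))
    then show "comb W (Suc n) (butterfly s e @ butterfly s' e') $$ (a,b)
        = comb W n (s @ s') $$ (a div sys_dim n, b div sys_dim n) * comb W n (e @ e') $$ (a mod sys_dim n, b mod sys_dim n)"
      using kron_entry[OF density_carrier[OF density_comb] density_carrier[OF density_comb] ab] by simp
  qed
  also have "\<dots> = (\<Sum>s'\<in>bitvecs m. comb W n (s @ s') $$ (a div sys_dim n, b div sys_dim n)) *
      (\<Sum>e'\<in>bitvecs m. comb W n (e @ e') $$ (a mod sys_dim n, b mod sys_dim n))"
    by (simp add: sum_product)
  also have "\<dots> / 2 ^ (2 * m) = \<rho> n s $$ (a div sys_dim n, b div sys_dim n) * \<rho> n e $$ (a mod sys_dim n, b mod sys_dim n)"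
    using avg_state_entry[OF m] avg_state_entry[of e m n] m assms(1) div_mod_less[OF ab(1)] div_mod_less[OF ab(2)]
    by (simp add: mult_2 power_add)
  finally show "\<rho> (Suc n) (butterfly s e) $$ (a,b) = kron (\<rho> n s) (\<rho> n e) $$ (a,b)"
    using kron_entry[OF avg_state_carrier avg_state_carrier ab] by simp
qed

text \<open>The conditional entropy H(B^N | U_1^j) for uniform input bits, the h(j) of the
  overview.\<close>

definition cond_entropy :: "nat \<Rightarrow> nat \<Rightarrow> real" where
  "cond_entropy n j = (\<Sum>u\<in>bitvecs j. vn_entropy (\<rho> n u)) / 2 ^ j"

text \<open>Even lengths suffice for the martingale property, because the two children of channel i
  telescope from prefix length 2 i - 2 to 2 i.\<close>

lemma cond_entropy_double:
  assumes "j \<le> 2 ^ n"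
  shows "cond_entropy (Suc n) (2 * j) = 2 * cond_entropy n j"
proof -
  have "(\<Sum>u\<in>bitvecs (2 * j). vn_entropy (\<rho> (Suc n) u))
      = (\<Sum>s\<in>bitvecs j. \<Sum>e\<in>bitvecs j. vn_entropy (\<rho> n s) + vn_entropy (\<rho> n e))"
    unfolding sum_bitvecs_butterfly
  proof (intro sum.cong refl)
    fix s e assume "s \<in> bitvecs j" "e \<in> bitvecs j"
    then show "vn_entropy (\<rho> (Suc n) (butterfly s e)) = vn_entropy (\<rho> n s) + vn_entropy (\<rho> n e)"
      using vn_entropy_kron[of "sys_dim n" "\<rho> n s" "sys_dim n" "\<rho> n e"] density_avg_state[of s n] density_avg_state[of e n] assms
      by (simp add: avg_state_butterfly density_def)
  qed
  also have "\<dots> = 2 * 2 ^ j * (\<Sum>u\<in>bitvecs j. vn_entropy (\<rho> n u))"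
    by (simp add: sum.distrib card_bitvecs flip: sum_distrib_left)
  finally show ?thesis by (simp add: cond_entropy_def power_even_eq power2_eq_square)
qed

text \<open>The register adds the entropy \<open>i - 1\<close> to both outputs and to their average,
  so it cancels. The first form transports bounds prefix by prefix, the second telescopes over
  children.\<close>

lemma sym_info_split_chan:
  assumes i: "i \<in> {1..2 ^ n}"
  shows "sym_info (split_chan W n i) = (\<Sum>u\<in>bitvecs (i - 1). sym_info (\<lambda>x. \<rho> n (u @ [x]))) / 2 ^ (i - 1)"
    and "sym_info (split_chan W n i) = cond_entropy n (i - 1) - cond_entropy n i"
proof -
  define m where "m = i - 1"
  have m: "m < 2 ^ n" "i = Suc m" using i by (auto simp: m_def)
  let ?S = "\<lambda>B. msum (2 ^ m * sys_dim n) (bitvecs m) (\<lambda>u. (1 / 2 ^ m :: complex) \<cdot>\<^sub>m kron (basis_proj (2 ^ m) (bits_to_nat u)) (B u))"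
  let ?B = "\<lambda>x u. \<rho> n (u @ [x])"
  have dB: "density (sys_dim n) (?B x u)" "density (sys_dim n) (\<rho> n u)" if "u \<in> bitvecs m" for x u
    using density_avg_state m that by auto
  have sc: "split_chan W n i x = ?S (?B x)" for x
    by (simp add: split_chan_def m)
  have avg: "(1/2::complex) \<cdot>\<^sub>m (?S (?B False) + ?S (?B True)) = ?S (\<rho> n)"
  proof (rule eq_matI)
    fix a b assume "a < dim_row (?S (\<rho> n))" "b < dim_col (?S (\<rho> n))"
    then have ab: "a < 2 ^ m * sys_dim n" "b < 2 ^ m * sys_dim n" by (auto simp: msum_def)
    have "?S (?B False) $$ (a,b) + ?S (?B True) $$ (a,b) = 2 * ?S (\<rho> n) $$ (a,b)"
    proof -
      let ?c = "\<lambda>u. 1 / 2 ^ m * (of_bool (a div sys_dim n = bits_to_nat u) * of_bool (b div sys_dim n = bits_to_nat u)) :: complex"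
      let ?a = "a mod sys_dim n" and ?b = "b mod sys_dim n"
      have split: "?B False u $$ (?a,?b) + ?B True u $$ (?a,?b) = 2 * \<rho> n u $$ (?a,?b)" if "u \<in> bitvecs m" for u
        using avg_state_split[of u n, symmetric] that m div_mod_less[OF ab(1)] div_mod_less[OF ab(2)]
          avg_state_carrier[of n "u @ [False]"] avg_state_carrier[of n "u @ [True]"]
        by simp
      have "?S (?B False) $$ (a,b) + ?S (?B True) $$ (a,b) = (\<Sum>u\<in>bitvecs m. ?c u * (?B False u $$ (?a,?b) + ?B True u $$ (?a,?b)))"
        unfolding cq_state_entry[OF avg_state_carrier ab] sum.distrib[symmetric] distrib_left ..
      also have "\<dots> = (\<Sum>u\<in>bitvecs m. 2 * (?c u * \<rho> n u $$ (?a,?b)))"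
        by (intro sum.cong refl) (simp only: split mult.left_commute)
      finally show ?thesis
        unfolding cq_state_entry[OF avg_state_carrier ab] sum_distrib_left .
    qed
    then show "((1/2::complex) \<cdot>\<^sub>m (?S (?B False) + ?S (?B True))) $$ (a,b) = ?S (\<rho> n) $$ (a,b)"
      using ab by simp
  qed (simp_all add: msum_def)
  have info: "sym_info (split_chan W n i) = (\<Sum>u\<in>bitvecs m. vn_entropy (\<rho> n u)) / 2 ^ m
     - (\<Sum>u\<in>bitvecs m. vn_entropy (?B False u)) / 2 ^ m / 2 - (\<Sum>u\<in>bitvecs m. vn_entropy (?B True u)) / 2 ^ m / 2"
    unfolding sym_info_def sc avg
    by (subst (1 2 3) vn_entropy_cq_state) (use dB in \<open>auto simp: field_simps\<close>)
  show "sym_info (split_chan W n i) = (\<Sum>u\<in>bitvecs (i - 1). sym_info (\<lambda>x. \<rho> n (u @ [x]))) / 2 ^ (i - 1)"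
    unfolding info m_def[symmetric] unfolding sym_info_def using m
    by (simp add: avg_state_split sum_subtractf diff_divide_distrib flip: sum_divide_distrib)
  show "sym_info (split_chan W n i) = cond_entropy n (i - 1) - cond_entropy n i"
    unfolding info m_def[symmetric] unfolding m(2) cond_entropy_def sum_bitvecs_snoc
    by (simp add: add_divide_distrib)
qed

text \<open>The overlap \<open>q\<close> averages \<open>Tr (\<surd>\<rho>\<^sub>0 \<surd>\<rho>\<^sub>1)\<close> over the prefixes; quantifying over the
  square roots \<open>S\<close> avoids having to show that positive square roots are unique.\<close>

definition overlap :: "nat \<Rightarrow> nat \<Rightarrow> real \<Rightarrow> bool" where
  "overlap n i q \<longleftrightarrow> (\<exists>S. (\<forall>u\<in>bitvecs i. psd (sys_dim n) (S u) \<and> S u * S u = \<rho> n u) \<and>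
     q = (\<Sum>u\<in>bitvecs (i - 1). Re (hs (sys_dim n) (S (u @ [False])) (S (u @ [True])))) / 2 ^ (i - 1))"

lemma overlap_ex:
  assumes "i \<in> {1..2 ^ n}"
  shows "\<exists>q. overlap n i q"
proof -
  have "\<exists>S. psd (sys_dim n) S \<and> S * S = \<rho> n u" if "u \<in> bitvecs i" for u
  proof -
    have "psd (sys_dim n) (\<rho> n u)" using density_avg_state[of u n] that assms by (simp add: density_def)
    from psd_sqrt[OF this] show ?thesis by metis
  qed
  then obtain S where "\<forall>u\<in>bitvecs i. psd (sys_dim n) (S u) \<and> S u * S u = \<rho> n u" by metis
  then show ?thesis unfolding overlap_def by blast
qed

lemma hs_psd_real: "psd k A \<Longrightarrow> psd k B \<Longrightarrow> hs k A B = of_real (Re (hs k A B))"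
  by (erule psd_spectral, erule psd_spectral) (simp add: spectral_hs)

lemma hs_commute: "Re (hs k A B) = Re (hs k B A)"
  unfolding hs_def Re_sum by (intro sum.cong refl) (simp add: mult.commute)

text \<open>Kronecker products T of the given square roots are square roots one level up, so the
  overlap factors for each pair of prefixes, and averages over independent prefixes
  multiply.\<close>

lemma overlap_square:
  assumes i: "i \<in> {1..2 ^ n}" and q: "overlap n i q"
  shows "overlap (Suc n) (2 * i) (q\<^sup>2)"
proof -
  define m where "m = i - 1"
  have m: "i = Suc m" using i by (simp add: m_def)
  obtain S where S: "\<And>u. u \<in> bitvecs i \<Longrightarrow> psd (sys_dim n) (S u) \<and> S u * S u = \<rho> n u"
    and qS: "q = (\<Sum>u\<in>bitvecs m. Re (hs (sys_dim n) (S (u @ [False])) (S (u @ [True])))) / 2 ^ m"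
    using q unfolding overlap_def m_def by blast
  define T where "T u = kron (S (parities u)) (S (evens u))" for u
  have T_butterfly: "T (butterfly s e) = kron (S s) (S e)" if "length s = length e" for s e
    using butterfly_inverse[OF that] by (simp add: T_def)
  have T: "psd (sys_dim (Suc n)) (T u) \<and> T u * T u = \<rho> (Suc n) u" if "u \<in> bitvecs (2 * i)" for u
  proof -
    define s e where "s = parities u" and "e = evens u"
    have u: "length s = i" "length e = i" "u = butterfly s e"
      using inverse_butterfly[of u i] that by (auto simp: s_def e_def)
    note Ss = S[of s] S[of e]
    have "T u * T u = kron (S s * S s) (S e * S e)"
      unfolding u(3) T_butterfly[OF trans[OF u(1) u(2)[symmetric]]] using Ss u
      by (intro kron_mult_kron[where d = "sys_dim n" and e = "sys_dim n"]) (auto intro: psd_carrier)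
    then show ?thesis
      using Ss u i unfolding sys_dim_Suc u(3) by (simp add: T_butterfly psd_kron avg_state_butterfly)
  qed
  define h where "h u = Re (hs (sys_dim n) (S (u @ [False])) (S (u @ [True])))" for u
  have hs_T: "Re (hs (sys_dim (Suc n)) (T (butterfly s e @ [z, False])) (T (butterfly s e @ [z, True]))) = h s * h e"
    if "s \<in> bitvecs m" "e \<in> bitvecs m" for s e z
  proof -
    \<comment> \<open>For the plus channel z is known and y is the input: y enters the second half
      directly and the first as z xor y. For z = True the first half has its labels swapped, which
      the symmetric h does not notice.\<close>
    have Tz: "T (butterfly s e @ [z, y]) = kron (S (s @ [z \<noteq> y])) (S (e @ [y]))" for y
      using T_butterfly[of "s @ [z \<noteq> y]" "e @ [y]"] butterfly_append[of s e "[z \<noteq> y]" "[y]"] that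
      by (cases z; cases y) simp_all
    have p: "psd (sys_dim n) (S (s @ [y]))" "psd (sys_dim n) (S (e @ [y]))" for y
      using S[of "s @ [y]"] S[of "e @ [y]"] that m by auto
    \<comment> \<open>\<open>Re\<close> splits over the product because the second factor, a pairing
      of psd matrices, is real.\<close>
    have "Re (hs (sys_dim (Suc n)) (T (butterfly s e @ [z, False])) (T (butterfly s e @ [z, True])))
       = Re (hs (sys_dim n) (S (s @ [z \<noteq> False])) (S (s @ [z \<noteq> True]))) * h e"
      unfolding Tz sys_dim_Suc hs_kron[OF psd_carrier[OF p(1)] psd_carrier[OF p(1)] psd_carrier[OF p(2)] psd_carrier[OF p(2)]] h_def
by (subst hs_psd_real[OF p(2) p(2)]) simp
    also have "Re (hs (sys_dim n) (S (s @ [z \<noteq> False])) (S (s @ [z \<noteq> True]))) = h s"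
      by (cases z) (simp_all add: h_def hs_commute)
    finally show ?thesis .
  qed
  \<comment> \<open>The prefix of a plus channel has odd length: the bit z doubles the sum, matching
    the extra 2 in the normalisation.\<close>
  have two_m: "2 * i - 1 = Suc (2 * m)" using m by simp
  have "(\<Sum>u\<in>bitvecs (2 * i - 1). Re (hs (sys_dim (Suc n)) (T (u @ [False])) (T (u @ [True]))))
      = 2 * (\<Sum>s\<in>bitvecs m. \<Sum>e\<in>bitvecs m. h s * h e)"
    unfolding two_m sum_bitvecs_snoc sum_bitvecs_butterfly using hs_T by simp
  also have "\<dots> = 2 * (q * 2 ^ m)\<^sup>2"
    by (simp add: qS h_def sum_product power2_eq_square)
  finally have "q\<^sup>2 = (\<Sum>u\<in>bitvecs (2 * i - 1). Re (hs (sys_dim (Suc n)) (T (u @ [False])) (T (u @ [True])))) / 2 ^ (2 * i - 1)"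
    unfolding two_m by (simp add: power_mult_distrib power_even_eq)
  then show ?thesis unfolding overlap_def using T by blast
qed

text \<open>For fixed \<epsilon> the bounds are affine in q, so they pass from single prefixes to
  averages; this is the reason for keeping \<epsilon> free.\<close>

lemma sym_info_split_chan_bounds:
  assumes i: "i \<in> {1..2 ^ n}" and q: "overlap n i q"
  shows "0 \<le> q" "0 \<le> sym_info (split_chan W n i)" "sym_info (split_chan W n i) \<le> 1"
    "1 - q / ln 2 \<le> sym_info (split_chan W n i)"
    "0 < \<epsilon> \<Longrightarrow> sym_info (split_chan W n i) \<le> 2 / ln 2 * (\<epsilon> + (1 - q) / (2 * \<epsilon>))"
proof -
  define m where "m = i - 1"
  have m: "i = Suc m" using i by (simp add: m_def)
  obtain S where S: "\<And>u. u \<in> bitvecs i \<Longrightarrow> psd (sys_dim n) (S u) \<and> S u * S u = \<rho> n u"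
    and qS: "q = (\<Sum>u\<in>bitvecs m. Re (hs (sys_dim n) (S (u @ [False])) (S (u @ [True])))) / 2 ^ m"
    using q unfolding overlap_def m_def by blast
  define h where "h u = Re (hs (sys_dim n) (S (u @ [False])) (S (u @ [True])))" for u
  define J where "J u = sym_info (\<lambda>x. \<rho> n (u @ [x]))" for u
  define E where "E f = (\<Sum>u\<in>bitvecs m. f u) / 2 ^ m" for f :: "bool list \<Rightarrow> real"
  have E_mono: "E f \<le> E g" if "\<And>u. u \<in> bitvecs m \<Longrightarrow> f u \<le> g u" for f g
    unfolding E_def using that by (intro divide_right_mono sum_mono) auto
  have E_affine: "E (\<lambda>u. a + b * f u) = a + b * E f" for a b f
    unfolding E_def by (simp add: sum.distrib card_bitvecs add_divide_distrib flip: sum_distrib_left)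
  have E_const: "E (\<lambda>u. a) = a" for a
    using E_affine[of a 0] by simp
  have q: "q = E h" unfolding qS E_def h_def ..
  have J: "sym_info (split_chan W n i) = E J"
    unfolding E_def J_def m_def by (rule sym_info_split_chan(1)[OF i])
  have p: "psd (sys_dim n) (S (u @ [x]))" "mtrace (S (u @ [x]) * S (u @ [x])) = 1"
    "(\<lambda>x. S (u @ [x]) * S (u @ [x])) = (\<lambda>x. \<rho> n (u @ [x]))" if "u \<in> bitvecs m" for u x
    using S[of "u @ [x]"] S[of "u @ [_]"] density_avg_state[of "u @ [x]" n] that m i by (auto simp: density_def)
  have hb: "0 \<le> J u" "J u \<le> 1" "1 - h u / ln 2 \<le> J u"
    "0 < \<epsilon> \<Longrightarrow> J u \<le> 2 / ln 2 * (\<epsilon> + (1 - h u) / (2 * \<epsilon>))" if "u \<in> bitvecs m" for u \<epsilon>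
    using holevo_bounds[of "sys_dim n" "\<lambda>x. S (u @ [x])", OF p(1)[OF that] p(2)[OF that]]
    unfolding p(3)[OF that] J_def h_def by blast+
  show "0 \<le> q"
    unfolding q h_def E_def using hs_psd_nonneg[OF p(1) p(1)] by (intro divide_nonneg_nonneg sum_nonneg) auto
  show "0 \<le> sym_info (split_chan W n i)"
    using E_mono[of "\<lambda>_. 0" J] hb(1) by (simp add: J E_const)
  show "sym_info (split_chan W n i) \<le> 1"
    using E_mono[of J "\<lambda>_. 1"] hb(2) by (simp add: J E_const)
  show "1 - q / ln 2 \<le> sym_info (split_chan W n i)"
    using E_mono[of "\<lambda>u. 1 + (- 1 / ln 2) * h u" J] hb(3) unfolding J q E_affine by simp
  show "sym_info (split_chan W n i) \<le> 2 / ln 2 * (\<epsilon> + (1 - q) / (2 * \<epsilon>))" if "0 < \<epsilon>"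
  proof -
    have eq: "2 / ln 2 * (\<epsilon> + (1 - x) / (2 * \<epsilon>)) = 2 / ln 2 * (\<epsilon> + 1 / (2 * \<epsilon>)) + (- 1 / (ln 2 * \<epsilon>)) * x" for x
      using that by (simp add: field_simps)
    show ?thesis unfolding J q eq E_affine[symmetric]
      by (rule E_mono) (use hb(4)[OF _ that] in \<open>simp only: eq\<close>)
  qed
qed

text \<open>At level 0 the register is trivial and no suffix remains, so the root of the tree, and
  with it the constant mean, carries the information of W.\<close>

lemma sym_info_split_chan_0: "sym_info (split_chan W 0 1) = sym_info W"
proof -
  have "\<rho> 0 [x] = W x" for x
  proof (rule eq_matI)
    fix a b assume "a < dim_row (W x)" "b < dim_col (W x)"
    then show "\<rho> 0 [x] $$ (a,b) = W x $$ (a,b)"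
      using avg_state_entry[of "[x]" 0 0 a b] density_carrier[OF density_W, of x] by auto
  qed (use avg_state_carrier[of 0 "[x]"] density_carrier[OF density_W, of x] in auto)
  then show ?thesis using sym_info_split_chan(1)[of 1 0] by simp
qed

sublocale polarization_process "\<lambda>n i. sym_info (split_chan W n i)" overlap
proof
  fix n i :: nat assume i: "i \<in> {1..2 ^ n}"
  obtain q where "overlap n i q" using overlap_ex[OF i] by blast
  then show "0 \<le> sym_info (split_chan W n i) \<and> sym_info (split_chan W n i) \<le> 1"
    using sym_info_split_chan_bounds[OF i] by blast
  \<comment> \<open>The sum over the children telescopes to h(2 i - 2) - h(2 i), where both lengths
    are even.\<close>
  have "2 * i - 1 \<in> {1..2 ^ Suc n}" "2 * i \<in> {1..2 ^ Suc n}" "2 * i - 1 - 1 = 2 * (i - 1)" "i - 1 \<le> 2 ^ n" using i by auto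
  then show "sym_info (split_chan W (Suc n) (2 * i - 1)) + sym_info (split_chan W (Suc n) (2 * i)) = 2 * sym_info (split_chan W n i)"
    using i cond_entropy_double[of i n] cond_entropy_double[OF \<open>i - 1 \<le> 2 ^ n\<close>] by (simp add: sym_info_split_chan(2))
qed (use overlap_ex overlap_square sym_info_split_chan_bounds in auto)

end

theorem theorem1:
  fixes W :: "bool \<Rightarrow> complex mat" and d :: nat and \<delta> :: real
  assumes "density_op d (W False)" and "density_op d (W True)"
    and "0 < \<delta>" and "\<delta> < 1"
  shows "((\<lambda>n. real (card {i \<in> {1..2^n}. sym_info (split_chan W n i) \<in> {1 - \<delta><..1}}) / 2^n)
            \<longlonglongrightarrow> sym_info W) \<and>
         ((\<lambda>n. real (card {i \<in> {1..2^n}. sym_info (split_chan W n i) \<in> {0..<\<delta>}}) / 2^n)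
            \<longlonglongrightarrow> 1 - sym_info W)"
proof -
  interpret cq_channel W d
    by standard (metis (full_types) assms(1,2) density_op_density)
  show ?thesis
    using fraction_near_1_tendsto[OF assms(3,4)] fraction_near_0_tendsto[OF assms(3,4)]
    unfolding sym_info_split_chan_0 ..
qed

end
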